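(* Let $k\ge1$ and $n-2k\ge5$, and let $R(\mu_3,1)(I)$ be the family of $(n+1)$-dimensional Leibniz algebras described in the context, with parameter set $I$. Up to isomorphism, $$R(\mu_3,1)(I)=\bigcup_{j=1}^{4}R(\mu_3,1)(I_j),$$ i.e. every algebra in the family $R(\mu_3,1)(I)$ is isomorphic to an algebra belonging to one of the following four subfamilies $R(\mu_3,1)(I_j)$ (in each of which all parameters of $I$ not mentioned are equal to zero): $I_1$: free parameters $a_i$ ($4\le i\le n-2k$), $\beta$, $\gamma$, $\delta_2$ (so in particular $a_1=a_2=0$); $I_2$: $a_2=-1$ and free parameters $a_i$ ($4\le i\le n-2k$), $b_2$, $\beta$, $\delta_3$, $\theta_n$ (so $a_1=0$); $I_3$: parameters $a_i$ ($2\le i\le n-2k$, $i\neq3$) and $\beta$, with $a_2\notin\{-1,0\}$ (so $a_1=0$); $I_4$: parameters $a_1,a_2,a_{n-2k},b_1,b_2,\delta_1,\delta_2,\delta_3,\theta_{n-k+i}$ ($1\le i\le k$), with $a_1\neq0$ and $$\delta_1=-a_1a_{n-2k},\qquad b_2=\frac{(-1)^{k-1}(a_2+1)^k\theta_n}{a_1},\qquad \theta_{n-k+i}=(-1)^{k-i}(a_2+1)^{k-i}\theta_n\ (1\le i\le k-1).$$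
   Context: A (right) Leibniz algebra is a vector space $L$ over $\mathbb{C}$ with a bilinear bracket satisfying $[x,[y,z]]=[[x,y],z]-[[x,z],y]$ for all $x,y,z\in L$. The family $R(\mu_3,1)(I)$: the parameter set is $I=\{a_i\ (1\le i\le n-2k,\ i\neq3),\ b_1,b_2,\beta,\gamma,\delta_1,\delta_2,\delta_3,\ \theta_{n-k+j}\ (1\le j\le k)\}$, complex numbers subject to $$(a_1+a_2)\gamma=0,\quad (n-2k-2)a_1\gamma=0,\quad \delta_1=-a_1a_{n-2k},\quad a_1b_2=(-1)^{k-1}(a_2+1)^k\theta_n,$$ $$\theta_{n-i}=(-1)^i(a_2+1)^i\theta_n\quad(0\le i\le k-1)$$ (powers with exponent $0$ equal $1$). The corresponding algebra has basis $\{e_1,\dots,e_{n-2k},f_1,\dots,f_{2k},x\}$ and multiplication table $$\begin{array}{ll} [e_i,e_1]=e_{i+1},&2\le i\le n-2k-1,\\ {}[e_2,f_i]=f_{k+i},&1\le i\le k,\\ {}[e_1,x]=a_1e_1+a_{n-2k}e_{n-2k}+b_1f_1+b_2f_{k+1},&\\ {}[e_2,x]=(a_1+a_2)e_2+\sum_{i=4}^{n-2k-1}a_ie_i+\beta e_{n-2k},&\\ {}[e_3,x]=(2a_1+a_2)e_3+\sum_{i=5}^{n-2k}a_{i-1}e_i+b_1f_{k+1},&\\ {}[e_i,x]=((i-1)a_1+a_2)e_i+\sum_{j=i+2}^{n-2k}a_{j-i+2}e_j,&4\le i\le n-2k,\\ {}[f_i,x]=-[x,f_i]=f_i+f_{i+1},&1\le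 i\le k-1,\\ {}[f_k,x]=-[x,f_k]=f_k,&\\ {}[f_{k+i},x]=(a_1+a_2+1)f_{k+i}+f_{k+i+1},&1\le i\le k-1,\\ {}[f_{2k},x]=(a_1+a_2+1)f_{2k},&\\ {}[x,e_1]=-a_1e_1-b_1f_1+\sum_{i=1}^{k}\theta_{n-k+i}f_{k+i},&\\ {}[x,e_2]=\gamma e_{n-2k},&\\ {}[x,x]=\delta_1e_{n-2k-1}+\delta_2e_{n-2k}+\delta_3f_{k+1},& \end{array}$$ with products not listed equal to zero (empty sums are $0$). *)

theory Defs
  imports Complex_Main "HOL-Library.Function_Algebras"
begin

text \<open>Addition is that of the type class; the underlying set may be a proper subset of the type.\<close>

record 'v algebraC =
  carr :: "'v set"
  scal :: "complex \<Rightarrow> 'v \<Rightarrow> 'v"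
  brac :: "'v \<Rightarrow> 'v \<Rightarrow> 'v"

definition leibniz_algebra :: "('v::ab_group_add) algebraC \<Rightarrow> bool" where
  "leibniz_algebra L \<longleftrightarrow>
     vector_space (scal L) \<and> module.subspace (scal L) (carr L) \<and>
     (\<forall>x\<in>carr L. \<forall>y\<in>carr L. brac L x y \<in> carr L) \<and>
     (\<forall>x\<in>carr L. \<forall>y\<in>carr L. \<forall>z\<in>carr L.
        brac L (x + y) z = brac L x z + brac L y z \<and>
        brac L x (y + z) = brac L x y + brac L x z) \<and>
     (\<forall>c. \<forall>x\<in>carr L. \<forall>y\<in>carr L.
        brac L (scal L c x) y = scal L c (brac L x y) \<and>
        brac L x (scal L c y) = scal L c (brac L x y)) \<and>
     (\<forall>x\<in>carr L. \<forall>y\<in>carr L. \<forall>z\<in>carr L.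
        brac L x (brac L y z) = brac L (brac L x y) z - brac L (brac L x z) y)"

definition algebra_iso ::
  "('v::ab_group_add) algebraC \<Rightarrow> ('w::ab_group_add) algebraC \<Rightarrow> ('v \<Rightarrow> 'w) \<Rightarrow> bool" where
  "algebra_iso L M \<phi> \<longleftrightarrow>
     bij_betw \<phi> (carr L) (carr M) \<and>
     (\<forall>x\<in>carr L. \<forall>y\<in>carr L. \<phi> (x + y) = \<phi> x + \<phi> y) \<and>
     (\<forall>c. \<forall>x\<in>carr L. \<phi> (scal L c x) = scal M c (\<phi> x)) \<and>
     (\<forall>x\<in>carr L. \<forall>y\<in>carr L. \<phi> (brac L x y) = brac M (\<phi> x) (\<phi> y))"

definition isomorphic_algebras ::
  "('v::ab_group_add) algebraC \<Rightarrow> ('w::ab_group_add) algebraC \<Rightarrow> bool" (infix "\<simeq>" 50) where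
  "L \<simeq> M \<longleftrightarrow> (\<exists>\<phi>. algebra_iso L M \<phi>)"

text \<open>Labels of the basis vectors $e_i$, $f_i$, $x$. Vectors are coordinate functions on labels,
  vanishing outside \<open>basis_labels n k\<close>.\<close>

datatype label = E nat | F nat | X

type_synonym cvec = "label \<Rightarrow> complex"

definition basis_labels :: "nat \<Rightarrow> nat \<Rightarrow> label set" where
  "basis_labels n k = E ` {1..n - 2*k} \<union> F ` {1..2*k} \<union> {X}"

definition smult :: "complex \<Rightarrow> cvec \<Rightarrow> cvec" (infixr "\<odot>" 75) where
  "c \<odot> v = (\<lambda>l. c * v l)"

definition unit_vec :: "label \<Rightarrow> cvec" where
  "unit_vec l = (\<lambda>l'. if l' = l then 1 else 0)"

abbreviation ee :: "nat \<Rightarrow> cvec" where "ee i \<equiv> unit_vec (E i)"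
abbreviation ff :: "nat \<Rightarrow> cvec" where "ff i \<equiv> unit_vec (F i)"

text \<open>The sequences \<open>a\<close> and \<open>\<theta>\<close> keep the original indices; only \<open>a 1\<close>, \<open>a 2\<close>, \<open>a 4\<close>, \dots,
  \<open>a (n - 2*k)\<close> and \<open>\<theta> (n - k + 1)\<close>, \dots, \<open>\<theta> n\<close> are used.\<close>

record params =
  a :: "nat \<Rightarrow> complex"
  b1 :: complex
  b2 :: complex
  \<beta> :: complex
  \<gamma> :: complex
  \<delta>1 :: complex
  \<delta>2 :: complex
  \<delta>3 :: complex
  \<theta> :: "nat \<Rightarrow> complex"

fun table :: "nat \<Rightarrow> nat \<Rightarrow> params \<Rightarrow> label \<Rightarrow> label \<Rightarrow> cvec" where
  "table n k P (E i) (E j) = (if j = 1 \<and> 2 \<le> i \<and> i \<le> n - 2*k - 1 then ee (i + 1) else 0)"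
| "table n k P (E i) (F j) = (if i = 2 \<and> 1 \<le> j \<and> j \<le> k then ff (k + j) else 0)"
| "table n k P (E i) X =
    (if i = 1 then a P 1 \<odot> ee 1 + a P (n - 2*k) \<odot> ee (n - 2*k) + b1 P \<odot> ff 1 + b2 P \<odot> ff (k + 1)
     else if i = 2 then
       (a P 1 + a P 2) \<odot> ee 2 + (\<Sum>j=4..n - 2*k - 1. a P j \<odot> ee j) + \<beta> P \<odot> ee (n - 2*k)
     else if i = 3 then
       (2 * a P 1 + a P 2) \<odot> ee 3 + (\<Sum>j=5..n - 2*k. a P (j - 1) \<odot> ee j) + b1 P \<odot> ff (k + 1)
     else if 4 \<le> i \<and> i \<le> n - 2*k then
       (of_nat (i - 1) * a P 1 + a P 2) \<odot> ee i + (\<Sum>j=i + 2..n - 2*k. a P (j - i + 2) \<odot> ee j)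
     else 0)"
| "table n k P (F i) (E j) = 0"
| "table n k P (F i) (F j) = 0"
| "table n k P (F i) X =
    (if 1 \<le> i \<and> i \<le> k - 1 then ff i + ff (i + 1)
     else if i = k then ff k
     else if k + 1 \<le> i \<and> i \<le> 2*k - 1 then (a P 1 + a P 2 + 1) \<odot> ff i + ff (i + 1)
     else if i = 2*k then (a P 1 + a P 2 + 1) \<odot> ff (2*k)
     else 0)"
| "table n k P X (E j) =
    (if j = 1 then
       - (a P 1 \<odot> ee 1) - b1 P \<odot> ff 1 + (\<Sum>i=1..k. \<theta> P (n - k + i) \<odot> ff (k + i))
     else if j = 2 then \<gamma> P \<odot> ee (n - 2*k)
     else 0)"
| "table n k P X (F j) =
    (if 1 \<le> j \<and> j \<le> k - 1 then - (ff j + ff (j + 1))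
     else if j = k then - ff k
     else 0)"
| "table n k P X X =
    \<delta>1 P \<odot> ee (n - 2*k - 1) + \<delta>2 P \<odot> ee (n - 2*k) + \<delta>3 P \<odot> ff (k + 1)"

definition R_alg :: "nat \<Rightarrow> nat \<Rightarrow> params \<Rightarrow> cvec algebraC" where
  "R_alg n k P =
    \<lparr>carr = {v. \<forall>l. l \<notin> basis_labels n k \<longrightarrow> v l = 0},
     scal = smult,
     brac = (\<lambda>v w. \<Sum>s\<in>basis_labels n k. \<Sum>t\<in>basis_labels n k.
               (v s * w t) \<odot> table n k P s t)\<rparr>"

definition R_family :: "nat \<Rightarrow> nat \<Rightarrow> params set \<Rightarrow> cvec algebraC set" where
  "R_family n k J = R_alg n k ` J"

definition par_I :: "nat \<Rightarrow> nat \<Rightarrow> params set" where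
  "par_I n k = {P.
     (a P 1 + a P 2) * \<gamma> P = 0 \<and>
     of_nat (n - 2*k - 2) * a P 1 * \<gamma> P = 0 \<and>
     \<delta>1 P = - a P 1 * a P (n - 2*k) \<and>
     a P 1 * b2 P = (-1) ^ (k - 1) * (a P 2 + 1) ^ k * \<theta> P n \<and>
     (\<forall>i\<in>{0..k - 1}. \<theta> P (n - i) = (-1) ^ i * (a P 2 + 1) ^ i * \<theta> P n)}"

text \<open>In the subfamilies every listed parameter that does not appear in the definition is free;
  "all other parameters are zero" only concerns the entries of \<open>a\<close> and \<open>\<theta>\<close> that are used.\<close>

definition par_I1 :: "nat \<Rightarrow> nat \<Rightarrow> params set" where
  "par_I1 n k = {P.
     a P 1 = 0 \<and> a P 2 = 0 \<and> b1 P = 0 \<and> b2 P = 0 \<and> \<delta>1 P = 0 \<and> \<delta>3 P = 0 \<and>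
     (\<forall>i\<in>{1..k}. \<theta> P (n - k + i) = 0)}"

definition par_I2 :: "nat \<Rightarrow> nat \<Rightarrow> params set" where
  "par_I2 n k = {P.
     a P 1 = 0 \<and> a P 2 = -1 \<and> b1 P = 0 \<and> \<gamma> P = 0 \<and> \<delta>1 P = 0 \<and> \<delta>2 P = 0 \<and>
     (\<forall>i\<in>{1..k - 1}. \<theta> P (n - k + i) = 0)}"

definition par_I3 :: "nat \<Rightarrow> nat \<Rightarrow> params set" where
  "par_I3 n k = {P.
     a P 1 = 0 \<and> a P 2 \<notin> {-1, 0} \<and> b1 P = 0 \<and> b2 P = 0 \<and> \<gamma> P = 0 \<and>
     \<delta>1 P = 0 \<and> \<delta>2 P = 0 \<and> \<delta>3 P = 0 \<and>
     (\<forall>i\<in>{1..k}. \<theta> P (n - k + i) = 0)}"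

definition par_I4 :: "nat \<Rightarrow> nat \<Rightarrow> params set" where
  "par_I4 n k = {P.
     a P 1 \<noteq> 0 \<and> (\<forall>i\<in>{4..n - 2*k - 1}. a P i = 0) \<and> \<beta> P = 0 \<and> \<gamma> P = 0 \<and>
     \<delta>1 P = - a P 1 * a P (n - 2*k) \<and>
     b2 P = (-1) ^ (k - 1) * (a P 2 + 1) ^ k * \<theta> P n / a P 1 \<and>
     (\<forall>i\<in>{1..k - 1}. \<theta> P (n - k + i) = (-1) ^ (k - i) * (a P 2 + 1) ^ (k - i) * \<theta> P n)}"

text \<open>Under the constraints of \<open>par_I\<close> the table does define a Leibniz algebra, on a space
  with a basis of $n+1$ labelled vectors. Below, \<open>E' i\<close> and \<open>F' i\<close> are the basis vectors
  extended by zero to all indices, which absorbs the boundary cases of the table.\<close>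

lemma sum_fun_at: "(\<Sum>i\<in>A. g i) l = (\<Sum>i\<in>A. (g i :: cvec) l)"
  by (induction A rule: infinite_finite_induct) auto

interpretation cv: vector_space smult
  by standard (auto simp: smult_def algebra_simps fun_eq_iff)

lemma finite_basis: "finite (basis_labels n k)"
  by (simp add: basis_labels_def)

abbreviation R_brac where "R_brac n k P \<equiv> brac (R_alg n k P)"

lemma R_brac_eq: "R_brac n k P v w =
    (\<Sum>s\<in>basis_labels n k. \<Sum>t\<in>basis_labels n k. (v s * w t) \<odot> table n k P s t)"
  by (simp add: R_alg_def)

lemma R_brac_add_left: "R_brac n k P (v + v') w = R_brac n k P v w + R_brac n k P v' w"
  by (simp add: R_brac_eq algebra_simps cv.scale_left_distrib sum.distrib)

lemma R_brac_add_right: "R_brac n k P v (w + w') = R_brac n k P v w + R_brac n k P v w'"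
  by (simp add: R_brac_eq algebra_simps cv.scale_left_distrib sum.distrib)

lemma R_brac_smult_left: "R_brac n k P (c \<odot> v) w = c \<odot> R_brac n k P v w"
  by (simp add: R_brac_eq cv.scale_sum_right) (simp add: smult_def algebra_simps)

lemma R_brac_smult_right: "R_brac n k P v (c \<odot> w) = c \<odot> R_brac n k P v w"
  by (simp add: R_brac_eq cv.scale_sum_right) (simp add: smult_def algebra_simps)

lemma R_brac_zero: "R_brac n k P 0 w = 0" "R_brac n k P v 0 = 0"
  by (simp_all add: R_brac_eq)

lemma R_brac_uminus: "R_brac n k P (- v) w = - R_brac n k P v w"
   "R_brac n k P v (- w) = - R_brac n k P v w"
  by (metis R_brac_smult_left cv.scale_minus_left cv.scale_one)
     (metis R_brac_smult_right cv.scale_minus_left cv.scale_one)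

lemma R_brac_diff: "R_brac n k P (v - v') w = R_brac n k P v w - R_brac n k P v' w"
   "R_brac n k P v (w - w') = R_brac n k P v w - R_brac n k P v w'"
  by (simp_all only: diff_conv_add_uminus R_brac_add_left R_brac_add_right R_brac_uminus)

lemma R_brac_sum: "R_brac n k P (\<Sum>i\<in>A. g i) w = (\<Sum>i\<in>A. R_brac n k P (g i) w)"
   "R_brac n k P v (\<Sum>i\<in>A. g i) = (\<Sum>i\<in>A. R_brac n k P v (g i))"
  by (induction A rule: infinite_finite_induct)
     (simp_all add: R_brac_zero R_brac_add_left R_brac_add_right)

lemmas R_brac_lin = R_brac_add_left R_brac_add_right R_brac_smult_left R_brac_smult_right
  R_brac_zero R_brac_uminus R_brac_diff R_brac_sum

lemma R_brac_unit:
  assumes "s \<in> basis_labels n k" "t \<in> basis_labels n k"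
  shows "R_brac n k P (unit_vec s) (unit_vec t) = table n k P s t"
proof -
  have "R_brac n k P (unit_vec s) (unit_vec t) =
     (\<Sum>s'\<in>basis_labels n k. if s' = s then
        (\<Sum>t'\<in>basis_labels n k. if t' = t then table n k P s t else 0) else 0)"
    unfolding R_brac_eq
    by (intro sum.cong refl) (auto simp: unit_vec_def intro!: sum.cong)
  then show ?thesis using assms finite_basis by simp
qed

lemma carr_expand:
  assumes "v \<in> carr (R_alg n k P)"
  shows "v = (\<Sum>s\<in>basis_labels n k. v s \<odot> unit_vec s)"
proof
  fix l
  have "(\<Sum>s\<in>basis_labels n k. v s \<odot> unit_vec s) l =
        (\<Sum>s\<in>basis_labels n k. if s = l then v l else 0)"
    by (auto simp: sum_fun_at smult_def unit_vec_def intro!: sum.cong)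
  also have "\<dots> = v l" using assms finite_basis[of n k] by (auto simp: R_alg_def)
  finally show "v l = (\<Sum>s\<in>basis_labels n k. v s \<odot> unit_vec s) l" by simp
qed

lemma in_basis_labels:
  "E i \<in> basis_labels n k \<longleftrightarrow> 1 \<le> i \<and> i \<le> n - 2*k"
  "F i \<in> basis_labels n k \<longleftrightarrow> 1 \<le> i \<and> i \<le> 2*k"
  "X \<in> basis_labels n k"
  by (auto simp: basis_labels_def)

lemma table_carr:
  assumes "k \<ge> 1" "n - 2*k \<ge> 5" "s \<in> basis_labels n k" "t \<in> basis_labels n k" "l \<notin> basis_labels n k"
  shows "table n k P s t l = 0"
  using assms
  by (cases s; cases t)
     (auto simp: in_basis_labels unit_vec_def smult_def sum_fun_at intro!: sum.neutral)

lemma leibniz_unit: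
  assumes nk: "k \<ge> 1" "n - 2*k \<ge> 5" and P: "P \<in> par_I n k"
    and B: "s \<in> basis_labels n k" "t \<in> basis_labels n k" "r \<in> basis_labels n k"
  shows "R_brac n k P (unit_vec s) (R_brac n k P (unit_vec t) (unit_vec r)) =
     R_brac n k P (R_brac n k P (unit_vec s) (unit_vec t)) (unit_vec r) -
     R_brac n k P (R_brac n k P (unit_vec s) (unit_vec r)) (unit_vec t)"
proof -
  define m where "m = n - 2*k"
  have m: "m \<ge> 5" "n - 2*k = m" using nk by (auto simp: m_def)
  define E' where "E' i = (if 1 \<le> i \<and> i \<le> m then ee i else 0)" for i
  define F' where "F' i = (if 1 \<le> i \<and> i \<le> 2*k then ff i else 0)" for i
  define X' where "X' = unit_vec X"
  define br where "br = R_brac n k P"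
  have lin: "br (v + v') w = br v w + br v' w" "br v (w + w') = br v w + br v w'"
    "br (c \<odot> v) w = c \<odot> br v w" "br v (c \<odot> w) = c \<odot> br v w"
    "br 0 w = 0" "br v 0 = 0" "br (-v) w = - br v w" "br v (-w) = - br v w"
    "br (v-v') w = br v w - br v' w" "br v (w-w') = br v w - br v w'"
    "br (\<Sum>i\<in>A. g i) w = (\<Sum>i\<in>A. br (g i) w)" "br v (\<Sum>i\<in>A. g i) = (\<Sum>i\<in>A. br v (g i))"
     for v v' w w' c g and A :: "nat set"
    by (simp_all add: br_def R_brac_lin)
  have EE: "br (E' i) (E' j) = (if j = 1 \<and> i \<ge> 2 then E' (i+1) else 0)" for i j
    by (auto simp: br_def E'_def R_brac_unit basis_labels_def R_brac_lin m)
  have EF: "br (E' i) (F' j) = (if i = 2 \<and> 1 \<le> j \<and> j \<le> k then F' (k+j) else 0)" for i j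
    using m by (auto simp: br_def E'_def F'_def R_brac_unit basis_labels_def R_brac_lin)
  have FE: "br (F' i) (E' j) = 0" for i j
    using m by (auto simp: br_def E'_def F'_def R_brac_unit basis_labels_def R_brac_lin)
  have FF: "br (F' i) (F' j) = 0" for i j
    using m by (auto simp: br_def E'_def F'_def R_brac_unit basis_labels_def R_brac_lin)
  have E1X: "br (E' 1) X' = a P 1 \<odot> E' 1 + a P m \<odot> E' m + b1 P \<odot> F' 1 + b2 P \<odot> F' (k + 1)"
    using m nk by (auto simp: br_def E'_def F'_def X'_def R_brac_unit basis_labels_def R_brac_lin)
  have E2X: "br (E' 2) X' = (a P 1 + a P 2) \<odot> E' 2 + (\<Sum>j=4..m - 1. a P j \<odot> E' j) + \<beta> P \<odot> E' m"
    using m nk by (auto simp: br_def E'_def X'_def R_brac_unit basis_labels_def R_brac_lin intro!: sum.cong)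
  have shift: "(\<Sum>j=i + 2..m. a P (j - i + 2) \<odot> ee j) = (\<Sum>j=4..m. a P j \<odot> E' (i + j - 2))"
    if "i \<ge> 2" for i
  proof -
    have "(\<Sum>j=4..m. a P j \<odot> E' (i + j - 2)) = (\<Sum>j\<in>{j\<in>{4..m}. i+j-2 \<le> m}. a P j \<odot> E' (i + j - 2))"
      by (rule sum.mono_neutral_right) (auto simp: E'_def)
    also have "\<dots> = (\<Sum>j=i + 2..m. a P (j - i + 2) \<odot> ee j)"
      by (rule sum.reindex_bij_witness[where i = "\<lambda>j. j - i + 2" and j = "\<lambda>j. i + j - 2"])
         (use that in \<open>auto simp: E'_def\<close>, simp flip: add_2_eq_Suc')
    finally show ?thesis by simp
  qed
  have EX: "br (E' i) X' = (of_nat (i - 1) * a P 1 + a P 2) \<odot> E' i + (\<Sum>j=4..m. a P j \<odot> E' (i + j - 2))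
     + (if i = 3 then b1 P \<odot> F' (k + 1) else 0)" if "i \<ge> 3" for i
  proof (cases "i = 3")
    case True
    have "(\<Sum>j=5..m. a P (j - 1) \<odot> ee j) = (\<Sum>j=3 + 2..m. a P (j - 3 + 2) \<odot> ee j)"
      by (rule sum.cong) (auto intro!: arg_cong[of _ _ "a P"])
    then show ?thesis using True m nk shift[of 3]
      by (auto simp: br_def E'_def F'_def X'_def R_brac_unit basis_labels_def R_brac_lin)
  next
    case False
    show ?thesis
    proof (cases "i \<le> m")
      case True
      then show ?thesis using False that m nk shift[of i]
        by (auto simp: br_def E'_def X'_def R_brac_unit basis_labels_def R_brac_lin)
    next
      case F: False
      then have "E' i = 0" "\<And>j. j \<ge> 4 \<Longrightarrow> E' (i+j-2) = 0" by (auto simp: E'_def)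
      then show ?thesis using F False by (auto simp: lin)
    qed
  qed
  have FX: "br (F' i) X' = F' i + (if i < k then F' (i+1) else 0)" if "i \<le> k" "i \<ge> 1" for i
    using that m nk by (auto simp: br_def F'_def X'_def R_brac_unit basis_labels_def R_brac_lin)
  have FkX: "br (F' i) X' = (a P 1 + a P 2 + 1) \<odot> F' i + F' (i+1)" if "i > k" for i
    using that m nk by (cases "i = 2*k") (auto simp: br_def F'_def X'_def R_brac_unit basis_labels_def R_brac_lin)
  have F0: "F' 0 = 0" "E' 0 = 0" by (auto simp: F'_def E'_def)
  have XE: "br X' (E' j) = (if j = 1 then - (a P 1 \<odot> E' 1) - b1 P \<odot> F' 1 + 
       (\<Sum>i=1..k. \<theta> P (n - k + i) \<odot> F' (k + i))
     else if j = 2 then \<gamma> P \<odot> E' m else 0)" for j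
    using m nk by (auto simp: br_def E'_def F'_def X'_def R_brac_unit basis_labels_def R_brac_lin intro!: sum.cong)
  have XF: "br X' (F' j) = (if 1 \<le> j \<and> j \<le> k then - (F' j + (if j < k then F' (j+1) else 0)) else 0)" for j
    using m nk by (auto simp: br_def F'_def X'_def R_brac_unit basis_labels_def R_brac_lin intro!: sum.cong)
  have XX: "br X' X' = \<delta>1 P \<odot> E' (m - 1) + \<delta>2 P \<odot> E' m + \<delta>3 P \<odot> F' (k + 1)"
    using m nk by (auto simp: br_def E'_def F'_def X'_def R_brac_unit basis_labels_def R_brac_lin intro!: sum.cong)

  note One_nat_def[simp del]
  have m1[simp]: "m - 1 \<noteq> 1" "m - 1 \<noteq> 2" "m - 1 \<ge> 2" "m - 1 + 1 = m" "Suc (m - 1) = m" "m \<noteq> 1" "m \<noteq> 2"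
    using m by auto
  have sm: "2 \<le> m" "1 \<le> k" using m nk by auto
  have Em[simp]: "E' (m + 1) = 0" "E' (Suc m) = 0" "\<And>i. i > m \<Longrightarrow> E' i = 0" by (auto simp: E'_def)
  have F2k[simp]: "F' (2*k+1) = 0" "F' (k+k+1) = 0" "F' (k+(k+1)) = 0" "F' (Suc (2*k)) = 0" "F' (Suc (k+k)) = 0"  by (auto simp: F'_def)
  let ?D = "\<lambda>s t r. br s (br t r) = br (br s t) r - br (br s r) t"
  have anti: "?D s r t" if "br s (br r t) = - br s (br t r)" "?D s t r" for s t r
    using that by (simp add: algebra_simps)
  have zl: "br (E' i) (E' j) = 0" if "j \<ge> 2" for i j using that by (simp add: EE)
  have DEEE: "?D (E' i) (E' j) (E' l)" for i j l
    by (auto simp: EE lin)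
  have DEEF: "?D (E' i) (E' j) (F' l)" for i j l
    by (auto simp: EE EF FE lin)
  have DEFE: "?D (E' i) (F' j) (E' l)" for i j l
    by (auto simp: EE EF FE lin)
  have DEFF: "?D (E' i) (F' j) (F' l)" for i j l
    by (auto simp: EE EF FF lin)
  have DFEE: "?D (F' i) (E' j) (E' l)" for i j l
    by (auto simp: EE FE lin)
  have DFEF: "?D (F' i) (E' j) (F' l)" for i j l
    by (auto simp: EF FE FF lin)
  have DFFE: "?D (F' i) (F' j) (E' l)" for i j l
    by (auto simp: FE FF lin)
  have DFFF: "?D (F' i) (F' j) (F' l)" for i j l
    by (auto simp: FF lin)

  have par: "(a P 1 + a P 2) * \<gamma> P = 0" "of_nat (m - 2) * a P 1 * \<gamma> P = 0"
     "\<delta>1 P = - a P 1 * a P m" "a P 1 * b2 P = (-1) ^ (k - 1) * (a P 2 + 1) ^ k * \<theta> P n"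
     "\<And>i. i \<le> k - 1 \<Longrightarrow> \<theta> P (n - i) = (-1) ^ i * (a P 2 + 1) ^ i * \<theta> P n"
    using P m by (auto simp: par_I_def)
  have E1r: "br (E' i) (br (E' 1) X') = a P 1 \<odot> br (E' i) (E' 1) + b1 P \<odot> br (E' i) (F' 1)" for i
    using m by (simp add: E1X lin EE EF)
  have E2r: "br (E' i) (br (E' 2) X') = 0" for i
    using m by (simp add: E2X lin EE)
  have E3r: "br (E' i) (br (E' j) X') = 0" if "j \<ge> 3" for i j
    using m that by (auto simp: EX lin EE EF intro!: sum.neutral)
  have DEEX: "?D (E' i) (E' j) X'" if ij: "i \<ge> 1" "j \<ge> 1" for i j
  proof -
    consider "j = 1" | "j = 2" | "j \<ge> 3" using ij by linarith
    then show ?thesis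
    proof cases
      case 1
      consider "i = 1" | "i = 2" | "i \<ge> 3" using ij by linarith
      then show ?thesis
      proof cases
        assume "i = 1" then show ?thesis using 1 m by (simp add: E1r lin EE EF FE E1X)
      next
        assume i: "i = 2"
        have S: "(\<Sum>j=4..m. a P j \<odot> E' (3 + j - 2)) = (\<Sum>j=4..m-1. a P j \<odot> E' (j + 1))"
        proof -
          have "(\<Sum>j=4..m. a P j \<odot> E' (3 + j - 2)) = (\<Sum>j=4..m. a P j \<odot> E' (j + 1))"
            by (rule sum.cong) (auto intro!: arg_cong[of _ _ E'])
          also have "\<dots> = (\<Sum>j=4..m-1. a P j \<odot> E' (j + 1))"
            by (rule sum.mono_neutral_right) (auto simp: E'_def)
          finally show ?thesis .
        qed
        have S2: "(\<Sum>j=4..m-1. a P j \<odot> br (E' j) (E' 1)) = (\<Sum>j=4..m-1. a P j \<odot> E' (j + 1))"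
          by (rule sum.cong) (auto simp: EE)
        have E3X: "br (E' 3) X' = (2 * a P 1 + a P 2) \<odot> E' 3 + (\<Sum>j=4..m-1. a P j \<odot> E' (j + 1)) + b1 P \<odot> F' (k + 1)"
          using EX[of 3] S by simp
        have l: "br (br (E' 2) X') (E' 1) = (a P 1 + a P 2) \<odot> E' 3 + (\<Sum>j=4..m-1. a P j \<odot> E' (j + 1))"
          using m(1) by (simp add: E2X lin S2) (simp add: EE)
        have e1: "br (E' 2) (br (E' 1) X') = a P 1 \<odot> E' 3 + b1 P \<odot> F' (k+1)"
          using sm by (simp add: E1r EE EF)
        have e2: "br (E' 2) (E' 1) = E' 3" by (simp add: EE)
        show ?thesis unfolding i 1 e1 l e2 E3X 
          by (simp add: fun_eq_iff smult_def algebra_simps)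
      next
        assume i: "i \<ge> 3"
        have S: "(\<Sum>j=4..m. a P j \<odot> br (E' (i + j - 2)) (E' 1)) = (\<Sum>j=4..m. a P j \<odot> E' (i + 1 + j - 2))"
          by (rule sum.cong) (use i in \<open>auto simp: EE Suc_diff_le\<close>)
        have l: "br (br (E' i) X') (E' 1) = (of_nat (i - 1) * a P 1 + a P 2) \<odot> E' (i+1) + (\<Sum>j=4..m. a P j \<odot> E' (i + 1 + j - 2))"
          using i by (simp only: EX[OF i] lin S) (simp add: EE FE lin)
        have l2: "br (br (E' i) (E' 1)) X' = (of_nat i * a P 1 + a P 2) \<odot> E' (i+1) + (\<Sum>j=4..m. a P j \<odot> E' (i + 1 + j - 2))"
          using i EX[of "i+1"] by (simp add: EE)
        have l3: "br (E' i) (br (E' 1) X') = a P 1 \<odot> E' (i+1)"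
          using i by (simp add: E1r EE EF)
        show ?thesis unfolding 1 l l2 l3 using i
          by (simp add: fun_eq_iff smult_def algebra_simps of_nat_diff)
      qed
    next
      case 2
      have "br (br (E' i) X') (E' 2) = 0"
      proof -
        consider "i = 1" | "i = 2" | "i \<ge> 3" using ij by linarith
        then show ?thesis by cases (auto simp: E1X E2X EX lin EE FE)
      qed
      then show ?thesis using 2 by (simp add: E2r EE lin)
    next
      case 3
      have "br (br (E' i) X') (E' j) = 0"
      proof -
        consider "i = 1" | "i = 2" | "i \<ge> 3" using ij by linarith
        then show ?thesis using 3 by cases (auto simp: E1X E2X EX lin EE FE)
      qed
      then show ?thesis using 3 by (simp add: E3r EE lin)
    qed
  qed
  have FXE: "br (br (F' i) X') (E' j) = 0" "br (br (F' i) X') (F' j) = 0" if ij: "i \<ge> 1" for i j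
    using ij by (cases "i \<le> k"; simp add: FX FkX lin FE FF)+
  have FbrEX: "br (F' i) (br (E' j) X') = 0" if ij: "j \<ge> 1" for i j
  proof -
    consider "j = 1" | "j = 2" | "j \<ge> 3" using ij by linarith
    then show ?thesis by cases (auto simp: E1X E2X EX lin FE FF)
  qed
  have FbrFX: "br (F' i) (br (F' j) X') = 0" if ij: "j \<ge> 1" for i j
    using ij by (cases "j \<le> k") (auto simp: FX FkX lin FF)
  have DFEX: "?D (F' i) (E' j) X'" if ij: "i \<ge> 1" "j \<ge> 1" for i j
    using ij by (simp add: FXE FbrEX lin FE)
  have DFFX: "?D (F' i) (F' j) X'" if ij: "i \<ge> 1" "j \<ge> 1" for i j
    using ij by (simp add: FXE FbrFX lin FF)
  have EXF: "br (br (E' i) X') (F' j) = (if i = 2 then (a P 1 + a P 2) \<odot> br (E' 2) (F' j) else 0)"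
     if ij: "i \<ge> 1" for i j
  proof -
    consider "i = 1" | "i = 2" | "i \<ge> 3" using ij by linarith
    then show ?thesis using m by cases (auto simp: E1X E2X EX lin EF FF intro!: sum.neutral)
  qed
  have FkX0: "br (F' (k + j)) X' = (a P 1 + a P 2 + 1) \<odot> F' (k + j) + F' (k + j + 1)" if "j \<ge> 1" for j
    using FkX[of "k+j"] that by simp
  have DEFX: "?D (E' i) (F' j) X'" if ij: "i \<ge> 1" "j \<ge> 1" for i j
  proof (cases "j \<le> k")
    case True
    have l: "br (E' 2) (br (F' j) X') = F' (k + j) + F' (k + j + 1)"
      using ij True by (cases "j = k") (auto simp: FX lin EF add.assoc)
    have l0: "br (E' i) (br (F' j) X') = 0" if "i \<noteq> 2"
      using ij True that by (auto simp: FX lin EF)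
    show ?thesis
    proof (cases "i = 2")
      case i: True
      have r: "br (E' 2) (F' j) = F' (k+j)" using ij True by (simp add: EF)
      show ?thesis unfolding i EXF[of 2, simplified] l r FkX0[OF ij(2)]
        by (simp add: fun_eq_iff smult_def algebra_simps)
    next
      case False
      then show ?thesis using ij l0 by (simp add: EXF) (simp add: EF lin)
    qed
  next
    case False
    then show ?thesis using ij by (simp add: EXF FkX EF lin)
  qed
  have sX: "br (E' i) (br X' (E' j)) = - br (E' i) (br (E' j) X')" 
           "br (F' i) (br X' (E' j)) = - br (F' i) (br (E' j) X')" 
           if ij: "j \<ge> 1" for i j
  proof -
    have th: "(\<Sum>j=1..k. \<theta> P (n - k + j) \<odot> br (E' i) (F' (k + j))) = 0" for i
      by (auto simp: EF intro!: sum.neutral)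
    consider "j = 1" | "j = 2" | "j \<ge> 3" using ij by linarith
    then show "br (E' i) (br X' (E' j)) = - br (E' i) (br (E' j) X')"
      using m(1) by cases (simp_all add: E2r E3r E1r, simp_all add: XE th lin, simp_all add: lin EE)
    show "br (F' i) (br X' (E' j)) = - br (F' i) (br (E' j) X')"
      using ij by (simp add: FbrEX) (simp add: XE lin FE FF)
  qed
  have sXF: "br (E' i) (br X' (F' j)) = - br (E' i) (br (F' j) X')" 
            "br (F' i) (br X' (F' j)) = - br (F' i) (br (F' j) X')" 
           if ij: "j \<ge> 1" for i j
    using ij by (cases "j \<le> k"; simp add: XF FX FkX lin EF FF)+
  have DEXE: "?D (E' i) X' (E' j)" "?D (F' i) X' (E' j)"  if ij: "i \<ge> 1" "j \<ge> 1" for i j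
    using anti[OF sX(1)[OF ij(2)] DEEX[OF ij]] anti[OF sX(2)[OF ij(2)] DFEX[OF ij]] by -
  have DEXF: "?D (E' i) X' (F' j)" "?D (F' i) X' (F' j)"  if ij: "i \<ge> 1" "j \<ge> 1" for i j
    using anti[OF sXF(1)[OF ij(2)] DEFX[OF ij]] anti[OF sXF(2)[OF ij(2)] DFFX[OF ij]] by -
  have DEXX: "?D (E' i) X' X'" "?D (F' i) X' X'" for i
    using m(1) by (simp_all add: XX lin EE EF FE FF)
  have XEE: "br (br X' (E' i)) (E' j) = 0" for i j
    using m(1) by (auto simp: XE lin EE FE EF FF)
  have DXEE: "?D X' (E' i) (E' j)" for i j
    by (simp only: XEE) (simp add: EE XE lin)
  have XEF: "br (br X' (E' i)) (F' j) = 0" for i j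
    using m(1) by (auto simp: XE lin EF FF)
  have XFE: "br (br X' (F' i)) (E' j) = 0" "br (br X' (F' i)) (F' j) = 0" for i j
    by (auto simp: XF lin FE FF)
  have DXEF: "?D X' (E' i) (F' j)" "?D X' (F' j) (E' i)"  "?D X' (F' l) (F' j)"  for i j l
    by (simp_all only: XEF XFE) (auto simp add: EF FE FF XF lin)
  have DXXX: "?D X' X' X'"
    using m(1) by (simp add: XX lin XE XF)
  have XXF: "br (br X' X') (F' j) = 0" for j
    using m(1) by (simp add: XX lin EF FF)
  have DXFX: "?D X' (F' j) X'" if ij: "j \<ge> 1" for j
  proof (cases "j \<le> k")
    case True
    then show ?thesis using ij by (simp only: XXF) (simp add: XF FX lin algebra_simps)
  next
    case False
    then show ?thesis using ij by (simp only: XXF) (simp add: XF FkX lin algebra_simps)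
  qed
  have DXXF: "?D X' X' (F' j)" if ij: "j \<ge> 1" for j
  proof (rule anti[OF _ DXFX[OF ij]])
    show "br X' (br X' (F' j)) = - br X' (br (F' j) X')"
      using ij by (cases "j \<le> k") (simp_all add: XF FX FkX lin)
  qed
  have XXE: "br (br X' X') (E' j) = (if j = 1 then \<delta>1 P \<odot> E' m else 0)" for j
    using m(1) by (simp add: XX lin EE FE)
  have Xsum: "br X' (\<Sum>j\<in>A. c j \<odot> E' (g j)) = 0" if "\<And>j. j \<in> A \<Longrightarrow> g j \<ge> 3" for A c and g :: "nat \<Rightarrow> nat"
  proof -
    have "br X' (E' (g j)) = 0" if "j \<in> A" for j
      using \<open>\<And>j. j \<in> A \<Longrightarrow> g j \<ge> 3\<close>[OF that] by (simp add: XE)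
    then show ?thesis by (simp add: lin sum.neutral)
  qed
  have z2: "br X' (\<Sum>j=4..m-1. a P j \<odot> E' j) = 0" by (rule Xsum) auto
  have DXEX: "?D X' (E' j) X'" if ij: "j \<ge> 1" for j
  proof -
    consider "j = 1" | "j = 2" | "j \<ge> 3" using ij by linarith
    then show ?thesis
    proof cases
      case 3
      have z: "br X' (\<Sum>i=4..m. a P i \<odot> E' (j + i - 2)) = 0" using 3 by (intro Xsum) auto
      have "br X' (br (E' j) X') = 0" using 3 by (simp only: EX[OF 3] lin(1-10) z) (simp add: XE XF lin)
      then show ?thesis using 3 by (simp only: XXE) (simp add: XE lin)
    next
      case 2
      have "br X' (br (E' 2) X') = (a P 1 + a P 2) \<odot> \<gamma> P \<odot> E' m"
        using m(1) by (simp add: E2X lin(1-10) z2 XE)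
      moreover have "br (br X' (E' 2)) X' = \<gamma> P \<odot> (of_nat (m - 1) * a P 1 + a P 2) \<odot> E' m"
      proof -
        have "(\<Sum>j=4..m. a P j \<odot> E' (m + j - 2)) = 0" by (auto simp: E'_def intro!: sum.neutral)
        then show ?thesis using m(1) EX[of m] by (simp add: XE lin)
      qed
      moreover have "\<gamma> P * (of_nat (m - 1) * a P 1 + a P 2) = (a P 1 + a P 2) * \<gamma> P"
      proof -
        have "m - 1 = m - 2 + 1" using m(1) by simp
        then have "complex_of_nat (m - 1) = of_nat (m - 2) + 1" by (metis of_nat_add of_nat_1)
        then have "\<gamma> P * (of_nat (m - 1) * a P 1 + a P 2) =
            of_nat (m - 2) * a P 1 * \<gamma> P + (a P 1 + a P 2) * \<gamma> P"
          by (simp only:) (simp add: algebra_simps)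
        then show ?thesis by (simp only: par(2)) simp
      qed
      ultimately show ?thesis using 2 by (simp only: XXE) (simp add: par(1) mult.commute)
    next
      case 1
      let ?T = "\<lambda>i. \<theta> P (n - k + i)"
      have rec: "(a P 2 + 1) * ?T (i + 1) + ?T i = 0" if "1 \<le> i" "i < k" for i
      proof -
        have "?T (i+1) = \<theta> P (n - (k - i - 1))" "?T i = \<theta> P (n - (k - i))"
          using that m nk by (auto intro!: arg_cong[of _ _ "\<theta> P"])
        moreover have "k - i = Suc (k - i - 1)" using that by simp
        ultimately show ?thesis using par(5)[of "k-i-1"] par(5)[of "k-i"] that by simp
      qed
      have rec1: "a P 1 * b2 P = (a P 2 + 1) * ?T 1"
      proof -
        have "?T 1 = \<theta> P (n - (k - 1))" using m nk by (auto intro!: arg_cong[of _ _ "\<theta> P"])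
        then have T: "?T 1 = (-1) ^ (k - 1) * (a P 2 + 1) ^ (k - 1) * \<theta> P n"
          using par(5)[of "k - 1"] by simp
        have "(a P 2 + 1) ^ k = (a P 2 + 1) * (a P 2 + 1) ^ (k - 1)"
          using nk by (simp add: power_eq_if)
        then show ?thesis unfolding par(4) T by (simp only: mult_ac)
      qed
      have "(\<Sum>i=1..p. ((a P 2 + 1) * ?T i) \<odot> F' (k + i) + ?T i \<odot> F' (k + i + 1)) =
           (a P 1 * b2 P) \<odot> F' (k + 1) + ?T p \<odot> F' (k + p + 1)" if "1 \<le> p" "p \<le> k" for p
        using that
      proof (induction p rule: dec_induct)
        case base
        show ?case by (simp add: rec1)
      next
        case (step p)
        have "{1..Suc p} = insert (p + 1) {1..p}" using step(1) by auto
        then have ins: "(\<Sum>i=1..Suc p. g i) = g (p + 1) + (\<Sum>i=1..p. g i)" for g :: "nat \<Rightarrow> cvec"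
          by simp
        have IH: "(\<Sum>i=1..p. ((a P 2 + 1) * ?T i) \<odot> F' (k + i) + ?T i \<odot> F' (k + i + 1)) =
           (a P 1 * b2 P) \<odot> F' (k + 1) + ?T p \<odot> F' (k + p + 1)"
          by (rule step.IH) (use step in auto)
        have "(\<Sum>i=1..Suc p. ((a P 2 + 1) * ?T i) \<odot> F' (k + i) + ?T i \<odot> F' (k + i + 1)) =
           (((a P 2 + 1) * ?T (p + 1)) \<odot> F' (k + (p + 1)) + ?T (p + 1) \<odot> F' (k + (p + 1) + 1))
           + ((a P 1 * b2 P) \<odot> F' (k + 1) + ?T p \<odot> F' (k + p + 1))"
          by (simp only: ins IH)
        also have "(a P 2 + 1) * ?T (p + 1) = - ?T p"
          using rec[of p] step by (simp add: add_eq_0_iff2)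
        finally have *: "(\<Sum>i=1..Suc p. ((a P 2 + 1) * ?T i) \<odot> F' (k + i) + ?T i \<odot> F' (k + i + 1)) =
           (- ?T p \<odot> F' (k + (p + 1)) + ?T (p + 1) \<odot> F' (k + (p + 1) + 1))
           + ((a P 1 * b2 P) \<odot> F' (k + 1) + ?T p \<odot> F' (k + p + 1))" .
        have **: "x = y + z" if "x = (- v + z) + (y + v)" for x y z v :: cvec
          using that by simp
        show ?case using **[OF *[unfolded cv.scale_minus_left add.assoc[of k p 1]]]
          by (simp only: Suc_eq_plus1)
      qed
      from this[of k] have key: "(\<Sum>i=1..k. ((a P 2 + 1) * ?T i) \<odot> F' (k + i) + ?T i \<odot> F' (k + i + 1)) =
           (a P 1 * b2 P) \<odot> F' (k + 1)" using sm by simp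
      have S1: "(\<Sum>i=1..k. ?T i \<odot> br (F' (k + i)) X') =
          a P 1 \<odot> (\<Sum>i=1..k. ?T i \<odot> F' (k + i)) + (a P 1 * b2 P) \<odot> F' (k + 1)"
      proof -
        have "(\<Sum>i=1..k. ?T i \<odot> br (F' (k + i)) X') =
           (\<Sum>i=1..k. a P 1 \<odot> ?T i \<odot> F' (k + i) + 
             (((a P 2 + 1) * ?T i) \<odot> F' (k + i) + ?T i \<odot> F' (k + i + 1)))"
        proof (rule sum.cong[OF refl])
          fix i assume "i \<in> {1..k}"
          then have "i \<ge> 1" by simp
          show "?T i \<odot> br (F' (k + i)) X' = a P 1 \<odot> ?T i \<odot> F' (k + i) + 
             (((a P 2 + 1) * ?T i) \<odot> F' (k + i) + ?T i \<odot> F' (k + i + 1))"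
            unfolding FkX0[OF \<open>i \<ge> 1\<close>] by (simp add: fun_eq_iff smult_def algebra_simps)
        qed
        also have "\<dots> = a P 1 \<odot> (\<Sum>i=1..k. ?T i \<odot> F' (k + i)) + (a P 1 * b2 P) \<odot> F' (k + 1)"
          by (simp only: sum.distrib[where g = "\<lambda>i. a P 1 \<odot> ?T i \<odot> F' (k + i)"] key cv.scale_sum_right)
        finally show ?thesis .
      qed
      define S where "S = (\<Sum>i=1..k. ?T i \<odot> F' (k + i))"
      have XE1: "br X' (E' 1) = - (a P 1 \<odot> E' 1) - b1 P \<odot> F' 1 + S" by (simp add: XE S_def)
      have S1': "br S X' = a P 1 \<odot> S + (a P 1 * b2 P) \<odot> F' (k + 1)"
        using S1 by (simp add: S_def lin)
      have F1: "br (F' 1) X' = F' 1 + (if 1 < k then F' 2 else 0)" using sm FX[of 1] by simp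
      have XF1: "br X' (F' 1) = - br (F' 1) X'" using sm XF[of 1] FX[of 1] by simp
      have l: "br X' (br (E' 1) X') = a P 1 \<odot> (- (a P 1 \<odot> E' 1) - b1 P \<odot> F' 1 + S) - b1 P \<odot> br (F' 1) X'"
        using XE[of m] XF[of "k+1"] by (simp add: E1X lin XE1 XF1)
      have r: "br (br X' (E' 1)) X' = 
          - (a P 1 \<odot> (a P 1 \<odot> E' 1 + a P m \<odot> E' m + b1 P \<odot> F' 1 + b2 P \<odot> F' (k + 1)))
          - b1 P \<odot> br (F' 1) X' + (a P 1 \<odot> S + (a P 1 * b2 P) \<odot> F' (k + 1))"
        by (simp only: XE1 lin S1' E1X)
      show ?thesis unfolding 1 l r XXE
        by (simp add: par(3) fun_eq_iff smult_def algebra_simps)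
    qed
  qed
  have DXXE: "?D X' X' (E' j)" if ij: "j \<ge> 1" for j
  proof (rule anti[OF _ DXEX[OF ij]])
    consider "j = 1" | "j = 2" | "j \<ge> 3" using ij by linarith
    then show "br X' (br X' (E' j)) = - br X' (br (E' j) X')"
    proof cases
      case 1
      have z: "(\<Sum>i=1..k. \<theta> P (n - k + i) \<odot> br X' (F' (k + i))) = 0"
        by (auto simp: XF intro!: sum.neutral)
      have "br X' (br X' (E' 1)) = - (a P 1 \<odot> br X' (E' 1)) - b1 P \<odot> br X' (F' 1)"
        by (simp only: XE[of 1] if_True simp_thms lin z) simp
      moreover have "br X' (br (E' 1) X') = a P 1 \<odot> br X' (E' 1) + b1 P \<odot> br X' (F' 1)"
        using XE[of m] XF[of "k+1"] by (simp add: E1X lin)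
      ultimately show ?thesis using 1 by simp
    next
      case 2
      have "br X' (br (E' 2) X') = (a P 1 + a P 2) \<odot> \<gamma> P \<odot> E' m"
        using m(1) by (simp add: E2X lin(1-10) z2 XE)
      then show ?thesis using 2 m(1) by (simp add: par(1)) (simp add: XE lin)
    next
      case 3
      have z: "br X' (\<Sum>i=4..m. a P i \<odot> E' (j + i - 2)) = 0" using 3 by (intro Xsum) auto
      have "br X' (br (E' j) X') = 0" using 3 by (simp only: EX[OF 3] lin(1-10) z) (simp add: XE XF lin)
      then show ?thesis using 3 by (simp add: XE lin)
    qed
  qed
  have B': "(\<exists>i\<ge>1. unit_vec u = E' i) \<or> (\<exists>i\<ge>1. unit_vec u = F' i) \<or> unit_vec u = X'"
    if "u \<in> basis_labels n k" for u
  proof (cases u)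
    case (E i)
    then have "i \<ge> 1" "unit_vec u = E' i" using that m by (auto simp: in_basis_labels E'_def)
    then show ?thesis by blast
  next
    case (F i)
    then have "i \<ge> 1" "unit_vec u = F' i" using that by (auto simp: in_basis_labels F'_def)
    then show ?thesis by blast
  qed (simp add: X'_def)
  show ?thesis
    using B'[OF B(1)]
  proof (elim disjE exE conjE, goal_cases)
    case (1 i)
    show ?case using B'[OF B(2)]
    proof (elim disjE exE conjE, goal_cases)
      case (1 j)
      show ?case using B'[OF B(3)] unfolding \<open>unit_vec s = _\<close> \<open>unit_vec t = _\<close> br_def[symmetric]
        using DEEE DEEF DEEX \<open>i \<ge> 1\<close> \<open>j \<ge> 1\<close> by metis
    next
      case (2 j)
      show ?case using B'[OF B(3)] unfolding \<open>unit_vec s = _\<close> \<open>unit_vec t = _\<close> br_def[symmetric]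
        using DEFE DEFF DEFX \<open>i \<ge> 1\<close> \<open>j \<ge> 1\<close> by metis
    next
      case 3
      show ?case using B'[OF B(3)] unfolding \<open>unit_vec s = _\<close> \<open>unit_vec t = _\<close> br_def[symmetric]
        using DEXE(1) DEXF(1) DEXX(1) \<open>i \<ge> 1\<close> by metis
    qed
  next
    case (2 i)
    show ?case using B'[OF B(2)]
    proof (elim disjE exE conjE, goal_cases)
      case (1 j)
      show ?case using B'[OF B(3)] unfolding \<open>unit_vec s = _\<close> \<open>unit_vec t = _\<close> br_def[symmetric]
        using DFEE DFEF DFEX \<open>i \<ge> 1\<close> \<open>j \<ge> 1\<close> by metis
    next
      case (2 j)
      show ?case using B'[OF B(3)] unfolding \<open>unit_vec s = _\<close> \<open>unit_vec t = _\<close> br_def[symmetric]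
        using DFFE DFFF DFFX \<open>i \<ge> 1\<close> \<open>j \<ge> 1\<close> by metis
    next
      case 3
      show ?case using B'[OF B(3)] unfolding \<open>unit_vec s = _\<close> \<open>unit_vec t = _\<close> br_def[symmetric]
        using DEXE(2) DEXF(2) DEXX(2) \<open>i \<ge> 1\<close> by metis
    qed
  next
    case 3
    show ?case using B'[OF B(2)]
    proof (elim disjE exE conjE, goal_cases)
      case (1 j)
      show ?case using B'[OF B(3)] unfolding \<open>unit_vec s = _\<close> \<open>unit_vec t = _\<close> br_def[symmetric]
        using DXEE DXEF(1) DXEX \<open>j \<ge> 1\<close> by metis
    next
      case (2 j)
      show ?case using B'[OF B(3)] unfolding \<open>unit_vec s = _\<close> \<open>unit_vec t = _\<close> br_def[symmetric]
        using DXEF(2,3) DXFX \<open>j \<ge> 1\<close> by metis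
    next
      case 3
      show ?case using B'[OF B(3)] unfolding \<open>unit_vec s = _\<close> \<open>unit_vec t = _\<close> br_def[symmetric]
        using DXXE DXXF DXXX by metis
    qed
  qed
qed

lemma R_alg_leibniz:
  assumes nk: "k \<ge> 1" "n - 2*k \<ge> 5" and P: "P \<in> par_I n k"
  shows "leibniz_algebra (R_alg n k P)"
proof -
  let ?L = "R_alg n k P" and ?B = "basis_labels n k"
  have sc: "scal ?L = smult" by (simp add: R_alg_def)
  have sub: "module.subspace smult (carr ?L)"
    by (auto simp: cv.subspace_def R_alg_def smult_def)
  have closed: "R_brac n k P v w \<in> carr ?L" for v w
    using table_carr[OF nk] by (auto simp: R_brac_eq R_alg_def sum_fun_at smult_def intro!: sum.neutral)
  let ?br = "R_brac n k P"
  have D: "?br v (?br w z) = ?br (?br v w) z - ?br (?br v z) w"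
    if v: "v \<in> carr ?L" and w: "w \<in> carr ?L" and z: "z \<in> carr ?L" for v w z
  proof -
    define D where "D v w z = ?br v (?br w z) - ?br (?br v w) z + ?br (?br v z) w" for v w z
    have D0: "D (unit_vec s) (unit_vec t) (unit_vec r) = 0" if "s \<in> ?B" "t \<in> ?B" "r \<in> ?B" for s t r
      using leibniz_unit[OF nk P that] by (simp add: D_def)
    have Dl: "D (\<Sum>s\<in>?B. c s \<odot> g s) w z = (\<Sum>s\<in>?B. c s \<odot> D (g s) w z)"
             "D w (\<Sum>s\<in>?B. c s \<odot> g s) z = (\<Sum>s\<in>?B. c s \<odot> D w (g s) z)"
             "D w z (\<Sum>s\<in>?B. c s \<odot> g s) = (\<Sum>s\<in>?B. c s \<odot> D w z (g s))" for c g w z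
      by (simp_all add: D_def R_brac_lin sum_subtractf sum.distrib cv.scale_right_distrib
            cv.scale_right_diff_distrib)
    have D_cong: "D v w z = D v' w' z'" if "v = v'" "w = w'" "z = z'" for v' w' z'
      using that by simp
    have "D v w z = D (\<Sum>s\<in>?B. v s \<odot> unit_vec s) (\<Sum>s\<in>?B. w s \<odot> unit_vec s) (\<Sum>s\<in>?B. z s \<odot> unit_vec s)"
      by (rule D_cong[OF carr_expand[OF v] carr_expand[OF w] carr_expand[OF z]])
    also have "\<dots> = 0" by (simp only: Dl) (simp add: D0 sum.neutral)
    finally show ?thesis unfolding D_def by (simp add: algebra_simps eq_neg_iff_add_eq_0)
  qed
  show ?thesis
    unfolding leibniz_algebra_def sc
    using sub closed D cv.vector_space_axioms by (simp add: R_brac_lin)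
qed

lemma card_basis_labels:
  assumes "n - 2*k \<ge> 5"
  shows "card (basis_labels n k) = n + 1"
proof -
  have "card (E ` {1..n - 2*k} \<union> F ` {1..2*k}) = (n - 2*k) + 2*k"
    by (subst card_Un_disjoint) (auto simp: card_image inj_on_def)
  moreover have "X \<notin> E ` {1..n - 2*k} \<union> F ` {1..2*k}" by auto
  ultimately show ?thesis using assms by (simp add: basis_labels_def)
qed

end

theory Submission
  imports Defs
begin

text \<open>
  Write \<open>m = n - 2k\<close>. Each reduction is a single unitriangular change of basis, and the split is by
  whether \<open>a\<^sub>1\<close> vanishes.

  Suppose \<open>a\<^sub>1 = 0\<close>. Right multiplication by \<open>x\<close> acts on \<open>f\<^sub>1, \<dots>, f\<^sub>k\<close> as a Jordan block with
  eigenvalue \<open>1\<close> and on \<open>f\<^bsub>k+1\<^esub>, \<dots>, f\<^bsub>2k\<^esub>\<close> as a Jordan block with eigenvalue \<open>a\<^sub>2 + 1\<close>, while \<open>e\<^sub>m\<close> is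
  an eigenvector for \<open>a\<^sub>2\<close>. An error term lying in a subspace on which this operator is invertible
  is removed by subtracting a preimage from \<open>e\<^sub>1\<close> or from \<open>x\<close>. The block for \<open>1\<close> is always
  invertible, so \<open>b\<^sub>1\<close> can be made zero; if \<open>a\<^sub>2 \<noteq> -1\<close>, then also \<open>b\<^sub>2\<close> and \<open>\<delta>\<^sub>3\<close>; if \<open>a\<^sub>2 \<noteq> 0\<close>, then also
  \<open>\<delta>\<^sub>2\<close>. The constraints of the family then force the remaining parameters: \<open>(a\<^sub>2 + 1)\<^sup>k \<theta>\<^sub>n = 0\<close>,
  \<open>\<theta>\<^bsub>n-i\<^esub> = (-1)\<^sup>i (a\<^sub>2 + 1)\<^sup>i \<theta>\<^sub>n\<close> and \<open>a\<^sub>2 \<gamma> = 0\<close>. The cases \<open>a\<^sub>2 = 0\<close>, \<open>a\<^sub>2 = -1\<close> and \<open>a\<^sub>2\<close> different from both give the families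
  \<open>I\<^sub>1\<close>, \<open>I\<^sub>2\<close>, \<open>I\<^sub>3\<close> (\<open>isomorphic_if_a1_zero\<close>, with \<open>chain_inverse\<close> for the Jordan blocks).

  Suppose \<open>a\<^sub>1 \<noteq> 0\<close>. Then \<open>\<gamma> = 0\<close>. Right multiplication by \<open>x\<close> is triangular on
  \<open>e\<^sub>2, e\<^sub>4, \<dots>, e\<^sub>m\<close> with diagonal entries \<open>(i - 1) a\<^sub>1 + a\<^sub>2\<close>, which are now pairwise distinct. Hence
  there is an eigenvector \<open>e\<^sub>2 + z\<close> with \<open>z\<close> in the span of \<open>e\<^sub>4, \<dots>, e\<^sub>m\<close> (\<open>eigenvector\<close>). Taking it as the
  new \<open>e\<^sub>2\<close> and its successive right products with \<open>e\<^sub>1\<close> as the new \<open>e\<^sub>3, \<dots>, e\<^sub>m\<close>, the Leibniz identity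
  carries the eigenvector equation along the chain, up to the term \<open>b\<^sub>1 f\<^bsub>k+1\<^esub>\<close> that \<open>[e\<^sub>3, x]\<close>
  contains in the table. So \<open>a\<^sub>4, \<dots>, a\<^bsub>m-1\<^esub>\<close> and \<open>\<beta>\<close> become zero and nothing else changes, which is the family \<open>I\<^sub>4\<close> (\<open>isomorphic_if_a1_nonzero\<close>).

  That the subfamilies lie in the whole family is a comparison of the defining equations
  (\<open>subfamilies_subset\<close>).
\<close>

section \<open>Isomorphisms from a unitriangular change of basis\<close>

text \<open>The value zero at labels outside the basis lets index shifts such as \<open>i \<mapsto> i + 1\<close> run off the
  end of a chain without a case distinction.\<close>

definition basis_vec :: "nat \<Rightarrow> nat \<Rightarrow> label \<Rightarrow> cvec" where
  "basis_vec n k s = (if s \<in> basis_labels n k then unit_vec s else 0)"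

text \<open>With the vectors \<open>v\<close> as images of the basis, this is the linear map that sends the unit vector
  at \<open>s\<close> to \<open>v s\<close>; it is the candidate isomorphism below.\<close>

definition lin_comb :: "nat \<Rightarrow> nat \<Rightarrow> (label \<Rightarrow> cvec) \<Rightarrow> cvec \<Rightarrow> cvec" where
  "lin_comb n k v w = (\<Sum>s\<in>basis_labels n k. w s \<odot> v s)"

lemma lin_comb_linear:
  "lin_comb n k v 0 = 0"
  "lin_comb n k v (w + w') = lin_comb n k v w + lin_comb n k v w'"
  "lin_comb n k v (c \<odot> w) = c \<odot> lin_comb n k v w"
  by (simp_all add: lin_comb_def cv.scale_left_distrib sum.distrib cv.scale_sum_right)
    (simp add: smult_def mult.assoc)

lemma lin_comb_uminus: "lin_comb n k v (- w) = - lin_comb n k v w"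
  by (metis lin_comb_linear(3) cv.scale_minus_left cv.scale_one)

lemma lin_comb_diff: "lin_comb n k v (w - w') = lin_comb n k v w - lin_comb n k v w'"
  by (simp only: diff_conv_add_uminus lin_comb_linear lin_comb_uminus)

lemma lin_comb_sum: "lin_comb n k v (\<Sum>i\<in>A. g i) = (\<Sum>i\<in>A. lin_comb n k v (g i))"
proof (induction A rule: infinite_finite_induct)
  case (insert i A)
  then show ?case by (simp only: sum.insert[OF insert.hyps] lin_comb_linear)
qed (simp_all only: sum.infinite sum.empty lin_comb_linear not_False_eq_True)

lemma lin_comb_basis_vec:
  "lin_comb n k v (basis_vec n k s) = (if s \<in> basis_labels n k then v s else 0)"
proof (cases "s \<in> basis_labels n k")
  case True
  have "lin_comb n k v (basis_vec n k s) = (\<Sum>t\<in>basis_labels n k. if t = s then v s else 0)"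
    using True unfolding lin_comb_def
    by (intro sum.cong refl) (auto simp: basis_vec_def unit_vec_def smult_def fun_eq_iff)
  then show ?thesis using True finite_basis by simp
qed (simp add: basis_vec_def lin_comb_linear)

lemmas lin_comb_simps = lin_comb_linear lin_comb_uminus lin_comb_diff lin_comb_sum lin_comb_basis_vec

lemma carr_expand_basis_vec:
  "w \<in> carr (R_alg n k P) \<Longrightarrow> w = lin_comb n k (basis_vec n k) w"
  using carr_expand[of w n k P] by (simp add: lin_comb_def basis_vec_def)

lemma carr_closed:
  "0 \<in> carr (R_alg n k P)"
  "u \<in> carr (R_alg n k P) \<Longrightarrow> w \<in> carr (R_alg n k P) \<Longrightarrow> u + w \<in> carr (R_alg n k P)"
  "w \<in> carr (R_alg n k P) \<Longrightarrow> c \<odot> w \<in> carr (R_alg n k P)"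
  "(\<And>i. i \<in> A \<Longrightarrow> g i \<in> carr (R_alg n k P)) \<Longrightarrow> (\<Sum>i\<in>A. g i) \<in> carr (R_alg n k P)"
  "basis_vec n k s \<in> carr (R_alg n k P)"
  by (auto simp: R_alg_def smult_def basis_vec_def unit_vec_def sum_fun_at intro!: sum.neutral)

lemma carr_indep: "carr (R_alg n k P) = carr (R_alg n k Q)"
  by (simp add: R_alg_def)

text \<open>A change of basis gives a map from the algebra with the new parameters to the given one; the
  reduction needs the opposite direction. The Leibniz hypothesis serves to make the carrier closed under
  the operations, so that the inverse map can be compared on sums and products.\<close>

lemma isomorphic_algebras_sym:
  assumes "leibniz_algebra L" "L \<simeq> M"
  shows "M \<simeq> L"
proof -
  obtain \<phi> where \<phi>: "algebra_iso L M \<phi>" using assms(2) by (auto simp: isomorphic_algebras_def)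
  define \<psi> where "\<psi> = the_inv_into (carr L) \<phi>"
  have bij: "bij_betw \<phi> (carr L) (carr M)" using \<phi> by (simp add: algebra_iso_def)
  have inv: "\<psi> (\<phi> u) = u" if "u \<in> carr L" for u
    using bij that by (simp add: \<psi>_def bij_betw_def the_inv_into_f_f)
  have onto: "\<exists>u\<in>carr L. w = \<phi> u" if "w \<in> carr M" for w
    using bij that by (auto simp: bij_betw_def)
  have vs: "vector_space (scal L)" and sub: "module.subspace (scal L) (carr L)"
    and br: "\<And>u w. u \<in> carr L \<Longrightarrow> w \<in> carr L \<Longrightarrow> brac L u w \<in> carr L"
    using assms(1) by (auto simp: leibniz_algebra_def)
  interpret vector_space "scal L" by (rule vs)
  have add: "u + w \<in> carr L" "scal L c u \<in> carr L" if "u \<in> carr L" "w \<in> carr L" for u w c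
    using sub that by (auto simp: subspace_def)
  have "\<psi> (u + w) = \<psi> u + \<psi> w" "\<psi> (scal M c u) = scal L c (\<psi> u)"
     "\<psi> (brac M u w) = brac L (\<psi> u) (\<psi> w)" if uw: "u \<in> carr M" "w \<in> carr M" for u w c
  proof -
    obtain u' w' where *: "u' \<in> carr L" "w' \<in> carr L" "u = \<phi> u'" "w = \<phi> w'"
      using onto uw by metis
    have "\<phi> (u' + w') = u + w" "\<phi> (scal L c u') = scal M c u" "\<phi> (brac L u' w') = brac M u w"
      using \<phi> * by (auto simp: algebra_iso_def)
    then show "\<psi> (u + w) = \<psi> u + \<psi> w" "\<psi> (scal M c u) = scal L c (\<psi> u)"
     "\<psi> (brac M u w) = brac L (\<psi> u) (\<psi> w)"
      using inv add br * by metis+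
  qed
  moreover have "bij_betw \<psi> (carr M) (carr L)"
    unfolding \<psi>_def using bij by (rule bij_betw_the_inv_into)
  ultimately have "algebra_iso M L \<psi>" by (auto simp: algebra_iso_def)
  then show ?thesis by (auto simp: isomorphic_algebras_def)
qed

text \<open>Injectivity: in a vector of the kernel, the coordinate of least rank among the nonzero ones is
  left unchanged by the map. Surjectivity: by induction from high rank to low rank, every basis vector is in the
  image, because it differs from an image by basis vectors of higher rank.\<close>

lemma unitriangular_bij:
  fixes v :: "label \<Rightarrow> cvec" and rk :: "label \<Rightarrow> nat"
  assumes v: "\<And>s. s \<in> basis_labels n k \<Longrightarrow> v s \<in> carr (R_alg n k P)"
    and tri: "\<And>s t. s \<in> basis_labels n k \<Longrightarrow> rk t \<le> rk s \<Longrightarrow> v s t = unit_vec s t"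
  shows "bij_betw (lin_comb n k v) (carr (R_alg n k P)) (carr (R_alg n k P))"
proof -
  let ?B = "basis_labels n k" and ?C = "carr (R_alg n k P)" and ?G = "lin_comb n k v"
  have maps: "?G w \<in> ?C" for w
    unfolding lin_comb_def by (intro carr_closed v)
  have kernel: "w = 0" if w: "w \<in> ?C" "?G w = 0" for w
  proof (rule ccontr)
    assume "w \<noteq> 0"
    then obtain l0 where "w l0 \<noteq> 0" by (auto simp: fun_eq_iff)
    then obtain l where l: "w l \<noteq> 0" and min: "\<And>s. w s \<noteq> 0 \<Longrightarrow> rk l \<le> rk s"
      using ex_has_least_nat[of "\<lambda>s. w s \<noteq> 0" l0 rk] by auto
    have lB: "l \<in> ?B" using w l by (auto simp: R_alg_def)
    have "?G w l = (\<Sum>s\<in>?B. w s * v s l)"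
      by (simp add: lin_comb_def sum_fun_at smult_def)
    also have "\<dots> = (\<Sum>s\<in>?B. if s = l then w l else 0)"
    proof (intro sum.cong refl)
      fix s assume s: "s \<in> ?B"
      show "w s * v s l = (if s = l then w l else 0)"
        using tri[OF s] min[of s] by (cases "w s = 0") (auto simp: unit_vec_def)
    qed
    also have "\<dots> = w l" using lB finite_basis by simp
    finally show False using w l by simp
  qed
  have "inj_on ?G ?C"
  proof (rule inj_onI)
    fix u w assume uw: "u \<in> ?C" "w \<in> ?C" "?G u = ?G w"
    have "u - w \<in> ?C" using uw by (auto simp: R_alg_def)
    moreover have "?G (u - w) = 0" using uw by (simp only: lin_comb_diff) simp
    ultimately have "u - w = 0" by (rule kernel)
    then show "u = w" by simp
  qed
  moreover have "?C \<subseteq> ?G ` ?C"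
  proof -
    have image_closed: "(\<Sum>i\<in>A. c i \<odot> g i) \<in> ?G ` ?C"
      if g: "\<And>i. i \<in> A \<Longrightarrow> g i \<in> ?G ` ?C" for A :: "label set" and c g
    proof -
      have "\<forall>i\<in>A. \<exists>u. u \<in> ?C \<and> g i = ?G u" using g by blast
      from bchoice[OF this] obtain h where h: "\<And>i. i \<in> A \<Longrightarrow> h i \<in> ?C \<and> g i = ?G (h i)"
        by blast
      have "(\<Sum>i\<in>A. c i \<odot> g i) = ?G (\<Sum>i\<in>A. c i \<odot> h i)"
        using h by (simp add: lin_comb_linear lin_comb_sum)
      moreover have "(\<Sum>i\<in>A. c i \<odot> h i) \<in> ?C" using h by (intro carr_closed) simp
      ultimately show ?thesis by blast
    qed
    have unit: "basis_vec n k s \<in> ?G ` ?C" if "s \<in> ?B" for s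
      using that
    proof (induction "card {t \<in> ?B. rk s < rk t}" arbitrary: s rule: less_induct)
      case less
      let ?D = "{t \<in> ?B. rk s < rk t}"
      have D: "basis_vec n k t \<in> ?G ` ?C" if t: "t \<in> ?D" for t
      proof (rule less.hyps)
        have "{r \<in> ?B. rk t < rk r} \<subset> ?D" using t by auto
        then show "card {r \<in> ?B. rk t < rk r} < card ?D"
          using finite_basis by (intro psubset_card_mono) auto
      qed (use t in simp)
      have w: "v s - basis_vec n k s \<in> ?C" (is "?w \<in> _")
        using v[OF less.prems] carr_closed(5)[of n k s P] by (auto simp: R_alg_def)
      have "?w = (\<Sum>t\<in>?B. ?w t \<odot> basis_vec n k t)"
        by (rule carr_expand_basis_vec[OF w, unfolded lin_comb_def])
      also have "\<dots> = (\<Sum>t\<in>?D. ?w t \<odot> basis_vec n k t)"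
      proof (rule sum.mono_neutral_right)
        show "\<forall>t\<in>?B - ?D. ?w t \<odot> basis_vec n k t = 0"
          using tri[OF less.prems] less.prems by (auto simp: basis_vec_def not_less)
      qed (use finite_basis in auto)
      also have "\<dots> \<in> ?G ` ?C" by (rule image_closed) (use D in simp)
      finally obtain h where h: "h \<in> ?C" "?w = ?G h" by auto
      have "basis_vec n k s = v s - ?w" by simp
      also have "\<dots> = ?G (basis_vec n k s - h)"
        using less.prems h by (simp add: lin_comb_simps)
      finally show ?case using h(1) carr_closed(5)[of n k s P] by (auto simp: R_alg_def)
    qed
    show ?thesis
    proof
      fix w assume "w \<in> ?C"
      then have "w = (\<Sum>s\<in>?B. w s \<odot> basis_vec n k s)"
        using carr_expand_basis_vec by (simp add: lin_comb_def)
      also have "\<dots> \<in> ?G ` ?C" by (intro image_closed unit)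
      finally show "w \<in> ?G ` ?C" .
    qed
  qed
  ultimately show ?thesis using maps by (auto simp: bij_betw_def)
qed

text \<open>The tool for both reductions: by bilinearity it is enough to check that the new basis vectors
  multiply in \<open>R_alg n k P\<close> according to the table of \<open>Q\<close>.\<close>

lemma isomorphic_by_change_of_basis:
  fixes v :: "label \<Rightarrow> cvec" and rk :: "label \<Rightarrow> nat"
  assumes L: "leibniz_algebra (R_alg n k Q)"
    and v: "\<And>s. s \<in> basis_labels n k \<Longrightarrow> v s \<in> carr (R_alg n k P)"
    and tri: "\<And>s t. s \<in> basis_labels n k \<Longrightarrow> rk t \<le> rk s \<Longrightarrow> v s t = unit_vec s t"
    and table: "\<And>s t. s \<in> basis_labels n k \<Longrightarrow> t \<in> basis_labels n k \<Longrightarrow>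
      R_brac n k P (v s) (v t) = lin_comb n k v (R_brac n k Q (basis_vec n k s) (basis_vec n k t))"
  shows "R_alg n k P \<simeq> R_alg n k Q"
proof (rule isomorphic_algebras_sym[OF L])
  let ?B = "basis_labels n k" and ?G = "lin_comb n k v"
  have "?G (R_brac n k Q u w) = R_brac n k P (?G u) (?G w)"
    if uw: "u \<in> carr (R_alg n k Q)" "w \<in> carr (R_alg n k Q)" for u w
  proof -
    have "R_brac n k Q u w = R_brac n k Q (lin_comb n k (basis_vec n k) u) (lin_comb n k (basis_vec n k) w)"
      using carr_expand_basis_vec[OF uw(1)] carr_expand_basis_vec[OF uw(2)] by simp
    also have "\<dots> = (\<Sum>t\<in>?B. w t \<odot> (\<Sum>s\<in>?B. u s \<odot> R_brac n k Q (basis_vec n k s) (basis_vec n k t)))"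
      by (simp add: lin_comb_def R_brac_lin)
    finally have "?G (R_brac n k Q u w) = (\<Sum>t\<in>?B. w t \<odot> (\<Sum>s\<in>?B. u s \<odot> R_brac n k P (v s) (v t)))"
      by (simp add: lin_comb_simps table)
    also have "\<dots> = R_brac n k P (?G u) (?G w)"
      by (simp add: lin_comb_def R_brac_lin)
    finally show ?thesis .
  qed
  then have "algebra_iso (R_alg n k Q) (R_alg n k P) ?G"
    using unitriangular_bij[of n k v P rk] v tri
    by (simp add: algebra_iso_def lin_comb_simps carr_indep[of n k Q P])
      (simp add: R_alg_def lin_comb_simps)
  then show "R_alg n k Q \<simeq> R_alg n k P" by (auto simp: isomorphic_algebras_def)
qed

section \<open>The multiplication table in uniform notation\<close>

locale table_shape =
  fixes n k m :: nat
  assumes k_pos: "k \<ge> 1" and m_ge: "m \<ge> 5" and m_eq: "n - 2 * k = m"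
begin

definition e :: "nat \<Rightarrow> cvec" where "e i = basis_vec n k (E i)"
definition f :: "nat \<Rightarrow> cvec" where "f i = basis_vec n k (F i)"
definition x :: cvec where "x = basis_vec n k X"

abbreviation br :: "params \<Rightarrow> cvec \<Rightarrow> cvec \<Rightarrow> cvec" where "br P \<equiv> R_brac n k P"

lemma e_eq: "e i = (if 1 \<le> i \<and> i \<le> m then ee i else 0)"
  and f_eq: "f i = (if 1 \<le> i \<and> i \<le> 2 * k then ff i else 0)"
  and x_eq: "x = unit_vec X"
  by (auto simp: e_def f_def x_def basis_vec_def in_basis_labels m_eq)

lemma e_beyond: "i > m \<Longrightarrow> e i = 0" and f_beyond: "i > 2 * k \<Longrightarrow> f i = 0"
  by (auto simp: e_eq f_eq)

lemmas br_basis_simps = e_eq f_eq x_eq R_brac_unit basis_labels_def R_brac_lin m_eq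

lemma br_ee: "br P (e i) (e j) = (if j = 1 \<and> i \<ge> 2 then e (i + 1) else 0)"
  by (auto simp: br_basis_simps)

lemma br_ef: "br P (e i) (f j) = (if i = 2 \<and> 1 \<le> j \<and> j \<le> k then f (k + j) else 0)"
  using m_ge by (auto simp: br_basis_simps)

lemma br_fe: "br P (f i) (e j) = 0" and br_ff: "br P (f i) (f j) = 0"
  using m_ge by (auto simp: br_basis_simps)

lemma br_e1x: "br P (e 1) x = a P 1 \<odot> e 1 + a P m \<odot> e m + b1 P \<odot> f 1 + b2 P \<odot> f (k + 1)"
  using m_ge k_pos by (auto simp: br_basis_simps)

lemma br_e2x:
  "br P (e 2) x = (a P 1 + a P 2) \<odot> e 2 + (\<Sum>j=4..m - 1. a P j \<odot> e j) + \<beta> P \<odot> e m"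
  using m_ge by (auto simp: br_basis_simps intro!: sum.cong)

lemma br_ex:
  assumes "i \<ge> 3"
  shows "br P (e i) x = (of_nat (i - 1) * a P 1 + a P 2) \<odot> e i
     + (\<Sum>j=4..m. a P j \<odot> e (i + j - 2)) + (if i = 3 then b1 P \<odot> f (k + 1) else 0)"
proof -
  have shift: "(\<Sum>j=i + 2..m. a P (j - i + 2) \<odot> ee j) = (\<Sum>j=4..m. a P j \<odot> e (i + j - 2))"
    if "i \<ge> 2" for i
  proof -
    have "(\<Sum>j=4..m. a P j \<odot> e (i + j - 2)) = (\<Sum>j\<in>{j\<in>{4..m}. i + j - 2 \<le> m}. a P j \<odot> e (i + j - 2))"
      by (rule sum.mono_neutral_right) (auto simp: e_eq)
    also have "\<dots> = (\<Sum>j=i + 2..m. a P (j - i + 2) \<odot> ee j)"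
      by (rule sum.reindex_bij_witness[where i = "\<lambda>j. j - i + 2" and j = "\<lambda>j. i + j - 2"])
        (use that in \<open>auto simp: e_eq\<close>, simp flip: add_2_eq_Suc')
    finally show ?thesis by simp
  qed
  consider "i = 3" | "i \<ge> 4" "i \<le> m" | "i > m" using assms by linarith
  then show ?thesis
  proof cases
    case 1
    have "(\<Sum>j=5..m. a P (j - 1) \<odot> ee j) = (\<Sum>j=3 + 2..m. a P (j - 3 + 2) \<odot> ee j)"
      by (rule sum.cong) (auto intro!: arg_cong[of _ _ "a P"])
    then show ?thesis using 1 k_pos m_ge shift[of 3] by (auto simp: br_basis_simps)
  next
    case 2
    then show ?thesis using shift[of i] by (auto simp: br_basis_simps)
  next
    case 3
    then have "e i = 0" "\<And>j. j \<ge> 4 \<Longrightarrow> e (i + j - 2) = 0" by (auto simp: e_eq)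
    then show ?thesis using 3 m_ge by (auto simp: R_brac_lin)
  qed
qed

lemma br_fx_low: "1 \<le> i \<Longrightarrow> i \<le> k \<Longrightarrow> br P (f i) x = f i + (if i < k then f (i + 1) else 0)"
  by (auto simp: br_basis_simps)

lemma br_fx_high: "i > k \<Longrightarrow> br P (f i) x = (a P 1 + a P 2 + 1) \<odot> f i + f (i + 1)"
  by (cases "i = 2 * k") (auto simp: br_basis_simps)

lemma br_xe: "br P x (e j) =
    (if j = 1 then - (a P 1 \<odot> e 1) - b1 P \<odot> f 1 + (\<Sum>i=1..k. \<theta> P (n - k + i) \<odot> f (k + i))
     else if j = 2 then \<gamma> P \<odot> e m else 0)"
  using m_ge k_pos by (auto simp: br_basis_simps intro!: sum.cong)

lemma br_xf: "br P x (f j) =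
    (if 1 \<le> j \<and> j \<le> k then - (f j + (if j < k then f (j + 1) else 0)) else 0)"
  by (auto simp: br_basis_simps)

lemma br_xx: "br P x x = \<delta>1 P \<odot> e (m - 1) + \<delta>2 P \<odot> e m + \<delta>3 P \<odot> f (k + 1)"
  using m_ge k_pos by (auto simp: br_basis_simps)

text \<open>The vectors \<open>e\<^sub>j\<close> with \<open>j \<ge> 3\<close> and \<open>f\<^sub>j\<close> with \<open>j > k\<close> annihilate everything from the right; this is
  why corrections taken from their span do not disturb products in which they are the right factor.\<close>

lemma br_e_right: "j \<ge> 3 \<Longrightarrow> br P y (e j) = 0"
  and br_f_right: "j > k \<Longrightarrow> br P y (f j) = 0"
proof -
  have table: "table n k P s (E j) = 0" if "j \<ge> 3" for s using that by (cases s) auto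
  show "br P y (e j) = 0" if "j \<ge> 3"
    unfolding R_brac_eq by (intro sum.neutral ballI) (use that table in \<open>auto simp: e_eq unit_vec_def\<close>)
  have table: "table n k P s (F j) = 0" if "j > k" for s using that by (cases s) auto
  show "br P y (f j) = 0" if "j > k"
    unfolding R_brac_eq by (intro sum.neutral ballI) (use that table in \<open>auto simp: f_eq unit_vec_def\<close>)
qed

lemma basis_coords:
  "e i X = 0" "e i (F j) = 0" "e i (E j) = (if i = j \<and> 1 \<le> i \<and> i \<le> m then 1 else 0)"
  "f i X = 0" "f i (E j) = 0" "x (E j) = 0" "x (F j) = 0" "x X = 1"
  by (auto simp: e_eq f_eq x_eq unit_vec_def)

lemma basis_carr: "e i \<in> carr (R_alg n k P)" "f i \<in> carr (R_alg n k P)" "x \<in> carr (R_alg n k P)"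
  by (simp_all add: e_def f_def x_def carr_closed)

lemma basis_cases:
  assumes "s \<in> basis_labels n k"
  obtains (E) i where "i \<ge> 1" "basis_vec n k s = e i"
    | (F) i where "i \<ge> 1" "basis_vec n k s = f i"
    | (X) "basis_vec n k s = x"
  using assms by (cases s) (auto simp: e_def f_def x_def in_basis_labels)

section \<open>The case \<open>a\<^sub>1 = 0\<close>\<close>

text \<open>A Jordan block \<open>g\<^sub>i \<mapsto> \<mu> g\<^sub>i + g\<^bsub>i+1\<^esub>\<close> with \<open>\<mu> \<noteq> 0\<close> is invertible, and the coefficients of the
  preimage of \<open>t g\<^sub>1\<close> are \<open>- t (- 1 / \<mu>)\<^sup>i\<close>, for which the sum telescopes. The coefficients are chosen
  before the chain \<open>g\<close>, so that the same ones can be used on \<open>f\<^sub>1, \<dots>, f\<^sub>k\<close> and on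
  \<open>f\<^bsub>k+1\<^esub>, \<dots>, f\<^bsub>2k\<^esub>\<close>.\<close>

lemma chain_inverse:
  fixes \<mu> t :: complex
  assumes "\<mu> \<noteq> 0 \<or> t = 0"
  obtains c where "\<And>g :: nat \<Rightarrow> cvec. g (k + 1) = 0 \<Longrightarrow>
    (\<Sum>i=1..k. c i \<odot> (\<mu> \<odot> g i + g (i + 1))) = t \<odot> g 1"
proof (cases "\<mu> = 0")
  case True
  then show ?thesis using assms that[of "\<lambda>_. 0"] by simp
next
  case False
  define c where "c i = - t * (- 1 / \<mu>) ^ i" for i
  have rec: "c (Suc i) * \<mu> = - c i" for i using False by (simp add: c_def)
  have partial: "(\<Sum>i=1..p. c i * (\<mu> * g i + g (i + 1))) = t * g 1 + c p * g (p + 1)"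
    for p and g :: "nat \<Rightarrow> complex"
  proof (induction p)
    case 0
    show ?case by (simp add: c_def)
  next
    case (Suc p)
    have "c (Suc p) * (\<mu> * g (Suc p)) = - c p * g (Suc p)"
      using rec[of p] by (simp flip: mult.assoc)
    then show ?case using Suc.IH by (simp add: algebra_simps)
  qed
  show ?thesis
  proof (rule that[of c])
    fix g :: "nat \<Rightarrow> cvec" assume "g (k + 1) = 0"
    then show "(\<Sum>i=1..k. c i \<odot> (\<mu> \<odot> g i + g (i + 1))) = t \<odot> g 1"
      using partial[of "\<lambda>i. g i l" k for l]
      by (simp add: fun_eq_iff sum_fun_at smult_def)
  qed
qed

text \<open>The new basis replaces \<open>e\<^sub>1\<close> by \<open>e\<^sub>1 + U + D\<close> and \<open>x\<close> by \<open>x + Z\<close>, where \<open>[U, x] = - b\<^sub>1 f\<^sub>1\<close>,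
  \<open>[D, x]\<close> accounts for the change of \<open>b\<^sub>2\<close>, and \<open>[Z, x]\<close> for the changes of \<open>\<delta>\<^sub>2\<close> and \<open>\<delta>\<^sub>3\<close>. Since
  \<open>[x, U] = - [U, x]\<close>, the term \<open>b\<^sub>1 f\<^sub>1\<close> disappears from \<open>[e\<^sub>1, x]\<close> and \<open>[x, e\<^sub>1]\<close> together. The product
  \<open>[e\<^sub>2, U] = U'\<close> has to be absorbed in \<open>e\<^sub>3\<close>, and this also removes \<open>b\<^sub>1 f\<^bsub>k+1\<^esub>\<close> from \<open>[e\<^sub>3, x]\<close>.\<close>

lemma isomorphic_if_a1_zero:
  assumes L: "leibniz_algebra (R_alg n k Q)" and a1: "a P 1 = 0"
    and same: "a Q = a P" "\<beta> Q = \<beta> P" "\<gamma> Q = \<gamma> P" "\<delta>1 Q = \<delta>1 P" "\<theta> Q = \<theta> P"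
    and b1: "b1 Q = 0"
    and b2\<delta>3: "a P 2 + 1 \<noteq> 0 \<or> b2 Q = b2 P \<and> \<delta>3 Q = \<delta>3 P"
    and \<delta>2: "a P 2 \<noteq> 0 \<or> \<delta>2 Q = \<delta>2 P"
  shows "R_alg n k P \<simeq> R_alg n k Q"
proof -
  \<comment> \<open>the table distinguishes the literal index 1, which must not turn into a successor\<close>
  note One_nat_def[simp del]
  obtain c where c: "\<And>g :: nat \<Rightarrow> cvec. g (k + 1) = 0 \<Longrightarrow>
      (\<Sum>i=1..k. c i \<odot> (1 \<odot> g i + g (i + 1))) = (- b1 P) \<odot> g 1"
    using chain_inverse[of 1 "- b1 P"] by auto
  obtain d where d: "\<And>g :: nat \<Rightarrow> cvec. g (k + 1) = 0 \<Longrightarrow>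
      (\<Sum>i=1..k. d i \<odot> ((a P 2 + 1) \<odot> g i + g (i + 1))) = (b2 Q - b2 P) \<odot> g 1"
    using chain_inverse[of "a P 2 + 1" "b2 Q - b2 P"] b2\<delta>3 by auto
  obtain h where h: "\<And>g :: nat \<Rightarrow> cvec. g (k + 1) = 0 \<Longrightarrow>
      (\<Sum>i=1..k. h i \<odot> ((a P 2 + 1) \<odot> g i + g (i + 1))) = (\<delta>3 Q - \<delta>3 P) \<odot> g 1"
    using chain_inverse[of "a P 2 + 1" "\<delta>3 Q - \<delta>3 P"] b2\<delta>3 by auto
  \<comment> \<open>if \<open>a\<^sub>2 = 0\<close>, the numerator is zero as well and the value is 0\<close>
  define r where "r = (\<delta>2 Q - \<delta>2 P) / a P 2"
  define U where "U = (\<Sum>i=1..k. c i \<odot> f i)"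
  define U' where "U' = (\<Sum>i=1..k. c i \<odot> f (k + i))"
  define D where "D = (\<Sum>i=1..k. d i \<odot> f (k + i))"
  define W where "W = (\<Sum>i=1..k. h i \<odot> f (k + i))"
  define Z where "Z = W + r \<odot> e m"
  note defs = U_def U'_def D_def Z_def W_def
  define corr where "corr s = (if s = E 1 then U + D else if s = E 3 then U' else if s = X then Z else 0)"
    for s
  define v where "v s = basis_vec n k s + corr s" for s
  let ?G = "lin_comb n k v"
  have right: "br P y D = 0" "br P y U' = 0" "br P y Z = 0" for y
    using m_ge by (simp_all add: defs R_brac_lin br_f_right br_e_right)
  have right_U: "br P (e i) U = (if i = 2 then U' else 0)" "br P (f i) U = 0" for i
    by (auto simp: defs R_brac_lin br_ef br_ff)
  have right_U2: "br P U U = 0" "br P D U = 0" "br P U' U = 0" "br P Z U = 0"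
    using m_ge by (simp_all add: U_def R_brac_lin br_ff) (simp_all add: defs R_brac_lin br_ff br_ef)
  have left: "br P w (e j) = 0" "br P w (f j) = 0" if "w \<in> {U, D, U', Z}" for w j
    using that m_ge by (auto simp: defs R_brac_lin br_fe br_ff br_ee br_ef e_beyond)
  note left = left[of U] left[of D] left[of U'] left[of Z]
  have shift_high: "(\<Sum>i=1..k. q i \<odot> br P (f (k + i)) x) =
      (\<Sum>i=1..k. q i \<odot> ((a P 2 + 1) \<odot> f (k + i) + f (k + (i + 1))))" for q
    by (intro sum.cong refl) (simp add: br_fx_high a1 add.assoc)
  have beyond: "f (k + (k + 1)) = 0" by (simp add: f_beyond)
  have Dx: "br P D x = (b2 Q - b2 P) \<odot> f (k + 1)"
    unfolding D_def R_brac_sum R_brac_smult_left shift_high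
    by (rule d[of "\<lambda>i. f (k + i)", OF beyond])
  have Wx: "br P W x = (\<delta>3 Q - \<delta>3 P) \<odot> f (k + 1)"
    unfolding W_def R_brac_sum R_brac_smult_left shift_high
    by (rule h[of "\<lambda>i. f (k + i)", OF beyond])
  have U'x: "br P U' x = a P 2 \<odot> U' - b1 P \<odot> f (k + 1)"
  proof -
    have "br P U' x = (\<Sum>i=1..k. a P 2 \<odot> c i \<odot> f (k + i) + c i \<odot> (1 \<odot> f (k + i) + f (k + (i + 1))))"
      unfolding U'_def R_brac_sum R_brac_smult_left shift_high
      by (intro sum.cong refl) (simp add: fun_eq_iff smult_def algebra_simps)
    also have "\<dots> = a P 2 \<odot> U' + (- b1 P) \<odot> f (k + 1)"
      unfolding sum.distrib c[of "\<lambda>i. f (k + i)", OF beyond] by (simp add: U'_def cv.scale_sum_right)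
    finally show ?thesis by simp
  qed
  \<comment> \<open>the low chain has to stop at \<open>k\<close>, although \<open>f\<^bsub>k+1\<^esub>\<close> is a basis vector\<close>
  define fl where "fl i = (if i \<le> k then f i else 0)" for i
  have shift_low: "(\<Sum>i=1..k. c i \<odot> (1 \<odot> fl i + fl (i + 1))) = - b1 P \<odot> f 1"
    using c[of fl] k_pos by (simp add: fl_def)
  have Ux: "br P U x = - (b1 P \<odot> f 1)"
  proof -
    have "br P U x = (\<Sum>i=1..k. c i \<odot> (1 \<odot> fl i + fl (i + 1)))"
      unfolding U_def R_brac_sum R_brac_smult_left
      by (intro sum.cong refl) (auto simp: br_fx_low fl_def)
    then show ?thesis unfolding shift_low by (simp add: cv.scale_minus_left)
  qed
  have xU: "br P x U = b1 P \<odot> f 1"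
  proof -
    have "br P x U = - br P U x"
      unfolding U_def R_brac_sum R_brac_smult_left R_brac_smult_right sum_negf[symmetric]
      by (intro sum.cong refl) (auto simp: br_fx_low br_xf fun_eq_iff smult_def algebra_simps)
    then show ?thesis by (simp add: Ux)
  qed
  have Zx: "br P Z x = (\<delta>2 Q - \<delta>2 P) \<odot> e m + (\<delta>3 Q - \<delta>3 P) \<odot> f (k + 1)"
  proof -
    have "(\<Sum>j=4..m. a P j \<odot> e (m + j - 2)) = 0"
      by (intro sum.neutral ballI) (auto simp: e_beyond)
    then have "br P (e m) x = a P 2 \<odot> e m" using m_ge by (simp add: br_ex a1)
    moreover have "r * a P 2 = \<delta>2 Q - \<delta>2 P" using \<delta>2 by (auto simp: r_def)
    ultimately show ?thesis by (simp add: Z_def R_brac_lin Wx)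
  qed
  note left_x = Ux Dx U'x Zx
  have Ge: "?G (e i) = e i + (if i = 1 then U + D else if i = 3 then U' else 0)" for i
  proof (cases "E i \<in> basis_labels n k")
    case True
    then show ?thesis by (simp add: e_def[of i] lin_comb_basis_vec v_def corr_def)
  next
    case False
    then have "e i = 0" "i \<noteq> 1" "i \<noteq> 3"
      using m_ge by (auto simp: e_def basis_vec_def in_basis_labels m_eq)
    then show ?thesis by (simp add: lin_comb_linear)
  qed
  have Gf: "?G (f i) = f i" for i
  proof (cases "F i \<in> basis_labels n k")
    case True
    then show ?thesis by (simp add: f_def[of i] lin_comb_basis_vec v_def corr_def)
  next
    case False
    then have "f i = 0" by (simp add: f_def basis_vec_def)
    then show ?thesis by (simp add: lin_comb_linear)
  qed
  have Gx: "?G x = x + Z"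
    by (simp add: x_def lin_comb_basis_vec v_def corr_def in_basis_labels)
  note G = Ge Gf Gx lin_comb_linear lin_comb_uminus lin_comb_diff lin_comb_sum
  have vG: "v s = ?G (basis_vec n k s)" if "s \<in> basis_labels n k" for s
    using that by (simp add: lin_comb_basis_vec)
  show ?thesis
  proof (rule isomorphic_by_change_of_basis[OF L, where v = v
        and rk = "\<lambda>s. case s of E i \<Rightarrow> i | F i \<Rightarrow> m + 1 | X \<Rightarrow> 0"])
    fix s assume s: "s \<in> basis_labels n k"
    show "v s \<in> carr (R_alg n k P)"
      by (auto simp: v_def corr_def defs intro!: carr_closed basis_carr)
    fix t
    show "v s t = unit_vec s t" if "(case t of E i \<Rightarrow> i | F i \<Rightarrow> m + 1 | X \<Rightarrow> 0)
        \<le> (case s of E i \<Rightarrow> i | F i \<Rightarrow> m + 1 | X \<Rightarrow> 0)"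
      using that s m_ge
      by (cases t) (auto simp: v_def corr_def defs basis_coords sum_fun_at smult_def basis_vec_def
          in_basis_labels m_eq unit_vec_def split: label.splits)
    assume t: "t \<in> basis_labels n k"
    show "br P (v s) (v t) = ?G (br Q (basis_vec n k s) (basis_vec n k t))"
      unfolding vG[OF s] vG[OF t]
      using s
    proof (cases rule: basis_cases)
      case (E i)
      from t show "br P (?G (basis_vec n k s)) (?G (basis_vec n k t)) =
        ?G (br Q (basis_vec n k s) (basis_vec n k t))"
      proof (cases rule: basis_cases)
        case E': (E j)
        show ?thesis unfolding E E'
          by (simp add: G br_ee R_brac_lin right right_U right_U2 left)
      next
        case F': (F j)
        show ?thesis unfolding E F'
          by (simp add: G br_ef R_brac_lin left)
      next
        case X': X
        consider "i = 1" | "i = 2" | "i \<ge> 3" using E by linarith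
        then show ?thesis
        proof cases
          case 1
          show ?thesis unfolding E X' 1 using m_ge
            by (simp add: G R_brac_lin right left_x br_e1x same b1 a1 cv.scale_left_diff_distrib)
        next
          case 2
          show ?thesis unfolding E X' 2 using m_ge
            by (simp add: G R_brac_lin right left_x br_e2x same a1)
        next
          case 3
          have "(\<Sum>j=4..m. a P j \<odot> ?G (e (i + j - 2))) = (\<Sum>j=4..m. a P j \<odot> e (i + j - 2))"
            using 3 by (intro sum.cong refl) (auto simp: G)
          then show ?thesis unfolding E X' using m_ge 3
            by (simp add: G(2-) R_brac_lin br_ex same a1 b1) (auto simp: Ge R_brac_lin right left_x br_ex a1 cv.scale_right_distrib)
        qed
      qed
    next
      case (F i)
      from t show "br P (?G (basis_vec n k s)) (?G (basis_vec n k t)) =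
        ?G (br Q (basis_vec n k s) (basis_vec n k t))"
      proof (cases rule: basis_cases)
        case E': (E j)
        show ?thesis unfolding F E' by (simp add: G br_fe R_brac_lin right right_U)
      next
        case F': (F j)
        show ?thesis unfolding F F' by (simp add: G br_ff R_brac_lin)
      next
        case X': X
        show ?thesis unfolding F X'
          by (cases "i \<le> k") (use F in \<open>simp_all add: G br_fx_low br_fx_high R_brac_lin right same\<close>)
      qed
    next
      case X
      from t show "br P (?G (basis_vec n k s)) (?G (basis_vec n k t)) =
        ?G (br Q (basis_vec n k s) (basis_vec n k t))"
      proof (cases rule: basis_cases)
        case E': (E j)
        show ?thesis unfolding X E' using m_ge
          by (simp add: G br_xe R_brac_lin right right_U2 left xU same a1 b1)
      next
        case F': (F j)
        show ?thesis unfolding X F' by (simp add: G br_xf R_brac_lin left)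
      next
        case X': X
        have "m - 1 \<noteq> 1" "m - 1 \<noteq> 3" "m \<noteq> 1" "m \<noteq> 3" using m_ge by auto
        then show ?thesis unfolding X X'
          by (simp add: G br_xx R_brac_lin right left_x same cv.scale_left_diff_distrib)
      qed
    qed
  qed
qed

section \<open>The case \<open>a\<^sub>1 \<noteq> 0\<close>\<close>

text \<open>The span of the \<open>e\<^sub>j\<close> with \<open>j \<ge> p\<close>, described by coordinates so that membership is checked
  pointwise.\<close>

definition e_tail :: "nat \<Rightarrow> cvec set" where
  "e_tail p = {w. \<forall>l. w l \<noteq> 0 \<longrightarrow> (\<exists>j. l = E j \<and> p \<le> j \<and> j \<le> m)}"

lemma e_tail_closed:
  "0 \<in> e_tail p"
  "u \<in> e_tail p \<Longrightarrow> w \<in> e_tail p \<Longrightarrow> u + w \<in> e_tail p"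
  "u \<in> e_tail p \<Longrightarrow> w \<in> e_tail p \<Longrightarrow> u - w \<in> e_tail p"
  "w \<in> e_tail p \<Longrightarrow> c \<odot> w \<in> e_tail p"
  "(\<And>i. i \<in> A \<Longrightarrow> g i \<in> e_tail p) \<Longrightarrow> (\<Sum>i\<in>A. g i) \<in> e_tail p"
  "j \<ge> p \<Longrightarrow> e j \<in> e_tail p"
proof -
  show "u + w \<in> e_tail p" "u - w \<in> e_tail p" if "u \<in> e_tail p" "w \<in> e_tail p"
    using that by (auto simp: e_tail_def) (metis add_0, metis)
  show "(\<Sum>i\<in>A. g i) \<in> e_tail p" if "\<And>i. i \<in> A \<Longrightarrow> g i \<in> e_tail p"
    using that by (auto simp: e_tail_def sum_fun_at) (metis sum.neutral)
qed (auto simp: e_tail_def smult_def e_eq unit_vec_def)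

lemma e_tail_mono: "w \<in> e_tail q \<Longrightarrow> p \<le> q \<Longrightarrow> w \<in> e_tail p"
  by (fastforce simp: e_tail_def)

lemma e_tail_trivial: "w \<in> e_tail p \<Longrightarrow> p > m \<Longrightarrow> w = 0"
  by (fastforce simp: e_tail_def fun_eq_iff)

lemma e_tail_expand:
  assumes "w \<in> e_tail p" "p \<ge> 1"
  shows "w = (\<Sum>j=p..m. w (E j) \<odot> e j)"
proof
  fix l
  have "(\<Sum>j=p..m. w (E j) \<odot> e j) l = (\<Sum>j=p..m. if E j = l then w l else 0)"
    using assms(2) by (auto simp: sum_fun_at smult_def e_eq unit_vec_def intro!: sum.cong)
  also have "\<dots> = w l"
  proof (cases "w l = 0")
    case False
    then obtain j where "l = E j" "p \<le> j" "j \<le> m" using assms(1) by (auto simp: e_tail_def)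
    then show ?thesis by simp
  qed (auto intro: sum.neutral)
  finally show "w l = (\<Sum>j=p..m. w (E j) \<odot> e j) l" by simp
qed

lemma e_tail_split:
  assumes "w \<in> e_tail p" "p \<ge> 1"
  shows "w - w (E p) \<odot> e p \<in> e_tail (p + 1)"
  using assms
  by (auto simp: e_tail_def smult_def e_eq unit_vec_def split: if_splits)

lemma e_tail_right: "w \<in> e_tail 3 \<Longrightarrow> br P y w = 0"
  by (subst e_tail_expand[of w 3]) (auto simp: R_brac_lin br_e_right)

lemma e_tail_left:
  assumes "w \<in> e_tail 3"
  shows "br P w (f j) = 0" "j \<ge> 2 \<Longrightarrow> br P w (e j) = 0"
  by (subst e_tail_expand[OF assms], simp, auto simp: R_brac_lin br_ef br_ee intro!: sum.neutral)+

lemma e_tail_shift: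
  assumes "w \<in> e_tail p" "p \<ge> 2"
  shows "br P w (e 1) \<in> e_tail (p + 1)"
  using assms
  by (subst e_tail_expand[OF assms(1)]) (auto simp: R_brac_lin br_ee intro!: e_tail_closed)

lemma e_tail_carr: "w \<in> e_tail p \<Longrightarrow> p \<ge> 1 \<Longrightarrow> w \<in> carr (R_alg n k P)"
  by (subst e_tail_expand[of w p]) (auto intro!: carr_closed basis_carr)

text \<open>The residual of \<open>e\<^sub>2 + z\<close> is pushed to higher and higher indices: its coefficient at \<open>e\<^sub>p\<close> can be
  cancelled by a multiple of \<open>e\<^sub>p\<close>, because the diagonal entries at \<open>e\<^sub>p\<close> and \<open>e\<^sub>2\<close> differ by
  \<open>(p - 2) a\<^sub>1 \<noteq> 0\<close>. Beyond \<open>m\<close> no residual is left.\<close>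

lemma eigenvector:
  assumes a1: "a P 1 \<noteq> 0"
  obtains z where "z \<in> e_tail 4" "br P (e 2 + z) x = (a P 1 + a P 2) \<odot> (e 2 + z)"
proof -
  note One_nat_def[simp del]
  define \<mu> where "\<mu> = a P 1 + a P 2"
  define res where "res z = br P (e 2 + z) x - \<mu> \<odot> (e 2 + z)" for z
  have "\<exists>z\<in>e_tail 4. res z \<in> e_tail p" if "4 \<le> p" "p \<le> m + 1" for p
    using that
  proof (induction p rule: dec_induct)
    case base
    have "res 0 = (\<Sum>j=4..m - 1. a P j \<odot> e j) + \<beta> P \<odot> e m"
      by (simp add: res_def br_e2x \<mu>_def)
    also have "\<dots> \<in> e_tail 4" using m_ge by (intro e_tail_closed) auto
    finally show ?case using e_tail_closed(1) by blast
  next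
    case (step p)
    then obtain z where z: "z \<in> e_tail 4" "res z \<in> e_tail p" by auto
    define t where "t = of_nat (p - 2) * a P 1"
    have "p - 2 \<noteq> 0" using step by simp
    then have t: "t \<noteq> 0" using a1 by (simp add: t_def del: of_nat_diff)
    define c where "c = res z (E p) / t"
    define u where "u = (\<Sum>j=4..m. a P j \<odot> e (p + j - 2))"
    have u: "u \<in> e_tail (p + 1)" unfolding u_def by (intro e_tail_closed) auto
    have "p - 1 = Suc (p - 2)" using step by simp
    then have ep: "br P (e p) x = (t + \<mu>) \<odot> e p + u"
      using step by (simp add: br_ex t_def \<mu>_def u_def algebra_simps)
    have "br P (e 2 + (z - c \<odot> e p)) x = br P (e 2 + z) x - c \<odot> br P (e p) x"
      by (simp add: R_brac_lin)
    then have "res (z - c \<odot> e p) = res z - c \<odot> (t \<odot> e p + u)"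
      unfolding res_def ep by (simp add: fun_eq_iff smult_def algebra_simps)
    also have "\<dots> = (res z - res z (E p) \<odot> e p) - c \<odot> u"
      using t by (simp add: c_def fun_eq_iff smult_def algebra_simps)
    also have "\<dots> \<in> e_tail (p + 1)"
      using step u by (intro e_tail_closed e_tail_split z) auto
    finally have "res (z - c \<odot> e p) \<in> e_tail (Suc p)" by (simp only: Suc_eq_plus1)
    moreover have "z - c \<odot> e p \<in> e_tail 4" using z step by (intro e_tail_closed) auto
    ultimately show ?case by blast
  qed
  from this[of "m + 1"] m_ge obtain z where "z \<in> e_tail 4" "res z \<in> e_tail (m + 1)" by auto
  then show ?thesis
    using e_tail_trivial[of "res z" "m + 1"] that[of z] by (simp add: res_def \<mu>_def)
qed

text \<open>The vectors \<open>T i\<close>, obtained from the eigenvector by right multiplication with \<open>e\<^sub>1\<close>, are the new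
  \<open>e\<^sub>i\<close> for \<open>i \<ge> 2\<close>. As \<open>T i - e\<^sub>i\<close> only involves indices from \<open>i + 2\<close> on, it has the same products as
  \<open>e\<^sub>i\<close> with the \<open>f\<^sub>j\<close> on its right and with all vectors on its left, and \<open>e\<^bsub>m-1\<^esub>\<close>, \<open>e\<^sub>m\<close>, which occur in \<open>[x, x]\<close> and \<open>[e\<^sub>1, x]\<close>, stay
  fixed. The products \<open>[T i, x]\<close> follow by induction from the Leibniz identity for \<open>T i, e\<^sub>1, x\<close>.\<close>

lemma isomorphic_if_a1_nonzero:
  assumes P: "P \<in> par_I n k" and L: "leibniz_algebra (R_alg n k Q)"
    and a1: "a P 1 \<noteq> 0" and \<gamma>: "\<gamma> P = 0" "\<gamma> Q = 0"
    and same: "a Q 1 = a P 1" "a Q 2 = a P 2" "a Q m = a P m" "b1 Q = b1 P" "b2 Q = b2 P"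
      "\<delta>1 Q = \<delta>1 P" "\<delta>2 Q = \<delta>2 P" "\<delta>3 Q = \<delta>3 P" "\<theta> Q = \<theta> P"
    and diag: "\<And>j. 4 \<le> j \<Longrightarrow> j < m \<Longrightarrow> a Q j = 0" "\<beta> Q = 0"
  shows "R_alg n k P \<simeq> R_alg n k Q"
proof -
  note One_nat_def[simp del]
  obtain z where z: "z \<in> e_tail 4" "br P (e 2 + z) x = (a P 1 + a P 2) \<odot> (e 2 + z)"
    using eigenvector[OF a1] .
  define T where "T i = ((\<lambda>y. br P y (e 1)) ^^ (i - 2)) (e 2 + z)" for i
  have T2: "T 2 = e 2 + z" by (simp add: T_def)
  have T_step: "br P (T i) (e 1) = T (i + 1)" if "i \<ge> 2" for i
  proof -
    have "i + 1 - 2 = Suc (i - 2)" using that by simp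
    then show ?thesis by (simp only: T_def) simp
  qed
  have T_tail: "T i - e i \<in> e_tail (i + 2)" if "i \<ge> 2" for i
    using that
  proof (induction i rule: dec_induct)
    case base
    show ?case using z by (simp add: T2)
  next
    case (step i)
    have "T (Suc i) - e (Suc i) = br P (T i - e i) (e 1)"
      using step T_step[of i] by (simp add: R_brac_lin br_ee Suc_eq_plus1)
    moreover have "br P (T i - e i) (e 1) \<in> e_tail (i + 2 + 1)"
      by (rule e_tail_shift[OF step.IH]) simp
    moreover have "i + 2 + 1 = Suc i + 2" by simp
    ultimately show ?case by (simp only:)
  qed
  have T_eq: "T i = e i" if "i + 1 \<ge> m" for i
    using e_tail_trivial[OF T_tail[of i]] that m_ge by simp
  have T_carr: "T i \<in> carr (R_alg n k P)" if "i \<ge> 2" for i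
    using carr_closed(2)[OF e_tail_carr[OF T_tail[OF that]] basis_carr(1)[of i]] by simp
  have T_split: "\<exists>w\<in>e_tail 3. T i = e i + w" if "i \<ge> 2" for i
    using e_tail_mono[OF T_tail[OF that], of 3] that by (intro bexI[of _ "T i - e i"]) auto
  have Tf: "br P (T i) (f j) = br P (e i) (f j)" and Te: "j \<ge> 2 \<Longrightarrow> br P (T i) (e j) = 0"
    and yT: "br P y (T i) = br P y (e i)" if i: "i \<ge> 2" for i j y
    using T_split[OF i] by (auto simp: R_brac_lin e_tail_left e_tail_right br_ee)
  have Tx: "br P (T i) x = (of_nat (i - 1) * a P 1 + a P 2) \<odot> T i
      + (if i = 3 then b1 P \<odot> f (k + 1) else 0)" if "i \<ge> 2" for i
    using that
  proof (induction i rule: dec_induct)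
    case base
    have "br P (T 2) x = (a P 1 + a P 2) \<odot> T 2" using z(2) unfolding T2 .
    then show ?case by simp
  next
    case (step i)
    have "br P (T i) (br P (e 1) x) = br P (br P (T i) (e 1)) x - br P (br P (T i) x) (e 1)"
      using R_alg_leibniz[OF k_pos _ P] m_ge m_eq T_carr[OF step.hyps(1)] basis_carr
      by (simp add: leibniz_algebra_def)
    then have "br P (T (i + 1)) x = br P (br P (T i) x) (e 1) + br P (T i) (br P (e 1) x)"
      using step by (simp add: T_step)
    also have "br P (br P (T i) x) (e 1) = (of_nat (i - 1) * a P 1 + a P 2) \<odot> T (i + 1)"
      unfolding step.IH R_brac_add_left R_brac_smult_left
      using step by (simp add: T_step br_fe R_brac_zero R_brac_smult_left)
    also have "br P (T i) (br P (e 1) x) = a P 1 \<odot> T (i + 1) + (if i = 2 then b1 P \<odot> f (k + 1) else 0)"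
      using step m_ge k_pos by (simp add: br_e1x R_brac_lin T_step Te Tf br_ef)
    also have "(of_nat (i - 1) * a P 1 + a P 2) \<odot> T (i + 1)
          + (a P 1 \<odot> T (i + 1) + (if i = 2 then b1 P \<odot> f (k + 1) else 0))
        = (of_nat i * a P 1 + a P 2) \<odot> T (i + 1) + (if i = 2 then b1 P \<odot> f (k + 1) else 0)"
    proof -
      have "of_nat (i - 1) * a P 1 + a P 2 + a P 1 = of_nat i * a P 1 + a P 2"
        using step by (simp add: of_nat_diff algebra_simps)
      then show ?thesis by (metis add.assoc cv.scale_left_distrib)
    qed
    finally show ?case by (simp add: Suc_eq_plus1)
  qed
  define v where "v s = (case s of E i \<Rightarrow> if i \<ge> 2 then T i else e i | _ \<Rightarrow> basis_vec n k s)" for s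
  let ?G = "lin_comb n k v"
  have Ge: "?G (e i) = (if i \<ge> 2 then T i else e i)" for i
  proof (cases "E i \<in> basis_labels n k")
    case True
    then show ?thesis by (simp add: e_def[of i] lin_comb_basis_vec v_def)
  next
    case False
    then have "e i = 0" by (simp add: e_def basis_vec_def)
    then show ?thesis using False T_eq[of i] m_ge by (auto simp: lin_comb_linear in_basis_labels m_eq)
  qed
  have Gf: "?G (f i) = f i" for i
  proof (cases "F i \<in> basis_labels n k")
    case True
    then show ?thesis by (simp add: f_def[of i] lin_comb_basis_vec v_def)
  next
    case False
    then have "f i = 0" by (simp add: f_def basis_vec_def)
    then show ?thesis by (simp add: lin_comb_linear)
  qed
  have Gx: "?G x = x"
    by (simp add: x_def lin_comb_basis_vec v_def in_basis_labels)
  note G = Ge Gf Gx lin_comb_linear lin_comb_uminus lin_comb_diff lin_comb_sum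
  have vG: "v s = ?G (basis_vec n k s)" if "s \<in> basis_labels n k" for s
    using that by (simp add: lin_comb_basis_vec)
  show ?thesis
  proof (rule isomorphic_by_change_of_basis[OF L, where v = v
        and rk = "\<lambda>s. case s of E i \<Rightarrow> i | F i \<Rightarrow> 0 | X \<Rightarrow> 0"])
    fix s assume s: "s \<in> basis_labels n k"
    show "v s \<in> carr (R_alg n k P)"
      by (auto simp: v_def T_carr intro!: carr_closed basis_carr split: label.splits)
    fix t
    show "v s t = unit_vec s t" if rk: "(case t of E i \<Rightarrow> i | F i \<Rightarrow> 0 | X \<Rightarrow> 0)
        \<le> (case s of E i \<Rightarrow> i | F i \<Rightarrow> 0 | X \<Rightarrow> 0)"
    proof (cases "\<exists>i\<ge>2. s = E i")
      case True
      then obtain i where i: "i \<ge> 2" "s = E i" by auto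
      have "(T i - e i) t = 0"
        using T_tail[OF i(1)] rk i by (auto simp: e_tail_def)
      then show ?thesis using i s by (simp add: v_def e_def basis_vec_def)
    next
      case False
      then show ?thesis using s by (auto simp: v_def e_def basis_vec_def split: label.splits)
    qed
    assume t: "t \<in> basis_labels n k"
    show "br P (v s) (v t) = ?G (br Q (basis_vec n k s) (basis_vec n k t))"
      unfolding vG[OF s] vG[OF t]
      using s
    proof (cases rule: basis_cases)
      case (E i)
      from t show "br P (?G (basis_vec n k s)) (?G (basis_vec n k t)) =
        ?G (br Q (basis_vec n k s) (basis_vec n k t))"
      proof (cases rule: basis_cases)
        case E': (E j)
        show ?thesis unfolding E E' using E'(1)
          by (cases "j = 1") (auto simp: G br_ee R_brac_lin yT Te T_step)
      next
        case F': (F j)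
        show ?thesis unfolding E F' by (simp add: G br_ef R_brac_lin Tf)
      next
        case X': X
        consider "i = 1" | "i = 2" | "i \<ge> 3" using E by linarith
        then show ?thesis
        proof cases
          case 1
          show ?thesis unfolding E X' 1 using m_ge
            by (simp add: G R_brac_lin br_e1x same T_eq)
        next
          case 2
          have "(\<Sum>j=4..m - 1. a Q j \<odot> e j) = 0"
            using m_ge by (intro sum.neutral) (auto simp: diag)
          then have "br Q (e 2) x = (a P 1 + a P 2) \<odot> e 2"
            by (simp add: br_e2x same diag)
          then show ?thesis unfolding E X' 2 by (simp add: G Tx)
        next
          case 3
          have "a Q j \<odot> e (i + j - 2) = 0" if "j \<in> {4..m}" for j
            using that diag(1)[of j] 3 by (cases "j = m") (auto simp: e_beyond)
          then have "(\<Sum>j=4..m. a Q j \<odot> e (i + j - 2)) = 0" by (intro sum.neutral) blast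
          then show ?thesis unfolding E X' using 3
            by (simp add: G br_ex[OF 3] same Tx)
        qed
      qed
    next
      case (F i)
      from t show "br P (?G (basis_vec n k s)) (?G (basis_vec n k t)) =
        ?G (br Q (basis_vec n k s) (basis_vec n k t))"
      proof (cases rule: basis_cases)
        case E': (E j)
        show ?thesis unfolding F E' by (simp add: G br_fe R_brac_lin yT)
      next
        case F': (F j)
        show ?thesis unfolding F F' by (simp add: G br_ff R_brac_lin)
      next
        case X': X
        show ?thesis unfolding F X'
          by (cases "i \<le> k") (use F in \<open>simp_all add: G br_fx_low br_fx_high R_brac_lin same\<close>)
      qed
    next
      case X
      from t show "br P (?G (basis_vec n k s)) (?G (basis_vec n k t)) =
        ?G (br Q (basis_vec n k s) (basis_vec n k t))"
      proof (cases rule: basis_cases)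
        case E': (E j)
        show ?thesis unfolding X E'
          by (simp add: G br_xe R_brac_lin yT same \<gamma>)
      next
        case F': (F j)
        show ?thesis unfolding X F' by (simp add: G br_xf R_brac_lin)
      next
        case X': X
        show ?thesis unfolding X X' using m_ge
          by (simp add: G br_xx R_brac_lin same T_eq)
      qed
    qed
  qed
qed

end

section \<open>The four subfamilies\<close>

text \<open>The whole family lists the parameters \<open>\<theta>\<close> downwards from \<open>n\<close>, the subfamilies list them upwards from
  \<open>n - k + 1\<close>.\<close>

lemma reverse_tail_index:
  fixes t q :: "nat \<Rightarrow> complex"
  assumes "k \<ge> 1" "k \<le> n"
  shows "(\<forall>i\<in>{0..k - 1}. t (n - i) = q i) \<longleftrightarrow> (\<forall>i\<in>{1..k}. t (n - k + i) = q (k - i))"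
proof
  assume *: "\<forall>i\<in>{0..k - 1}. t (n - i) = q i"
  show "\<forall>i\<in>{1..k}. t (n - k + i) = q (k - i)"
  proof
    fix i assume i: "i \<in> {1..k}"
    then have "t (n - (k - i)) = q (k - i)" using * assms by (intro bspec[OF *]) auto
    moreover have "n - (k - i) = n - k + i" using i assms by auto
    ultimately show "t (n - k + i) = q (k - i)" by (simp only:)
  qed
next
  assume *: "\<forall>i\<in>{1..k}. t (n - k + i) = q (k - i)"
  show "\<forall>i\<in>{0..k - 1}. t (n - i) = q i"
  proof
    fix i assume i: "i \<in> {0..k - 1}"
    then have "t (n - k + (k - i)) = q (k - (k - i))" using assms by (intro bspec[OF *]) auto
    moreover have "n - k + (k - i) = n - i" "k - (k - i) = i" using i assms by auto
    ultimately show "t (n - i) = q i" by (simp only:)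
  qed
qed

context table_shape
begin

lemma par_I_iff: "P \<in> par_I n k \<longleftrightarrow>
    (a P 1 + a P 2) * \<gamma> P = 0 \<and> a P 1 * \<gamma> P = 0 \<and> \<delta>1 P = - a P 1 * a P m \<and>
    a P 1 * b2 P = (-1) ^ (k - 1) * (a P 2 + 1) ^ k * \<theta> P n \<and>
    (\<forall>i\<in>{1..k}. \<theta> P (n - k + i) = (-1) ^ (k - i) * (a P 2 + 1) ^ (k - i) * \<theta> P n)"
proof -
  have "k \<le> n" using m_ge m_eq by simp
  note \<theta>_iff = reverse_tail_index[OF k_pos this, of "\<theta> P"
      "\<lambda>i. (-1) ^ i * (a P 2 + 1) ^ i * \<theta> P n"]
  have "m - 2 \<noteq> 0" using m_ge by simp
  then have "of_nat (m - 2) * a P 1 * \<gamma> P = 0 \<longleftrightarrow> a P 1 * \<gamma> P = 0" by (simp del: of_nat_diff)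
  moreover have "n - 2 * k - 2 = m - 2" using m_eq by simp
  ultimately show ?thesis unfolding par_I_def mem_Collect_eq \<theta>_iff m_eq by simp
qed

lemma subfamilies_subset:
  "par_I1 n k \<subseteq> par_I n k" "par_I2 n k \<subseteq> par_I n k"
  "par_I3 n k \<subseteq> par_I n k" "par_I4 n k \<subseteq> par_I n k"
proof -
  have top: "n - k + k = n" "k \<in> {1..k}" using m_ge m_eq k_pos by auto
  show "par_I1 n k \<subseteq> par_I n k" "par_I3 n k \<subseteq> par_I n k"
  proof -
    have "P \<in> par_I n k" if P: "P \<in> par_I1 n k \<or> P \<in> par_I3 n k" for P
    proof -
      have \<theta>: "\<forall>i\<in>{1..k}. \<theta> P (n - k + i) = 0"
        using P by (auto simp: par_I1_def par_I3_def)
      then have "\<theta> P (n - k + k) = 0" using top(2) by blast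
      then have "\<theta> P n = 0" by (simp only: top(1))
      then show ?thesis using P \<theta> by (auto simp: par_I1_def par_I3_def par_I_iff)
    qed
    then show "par_I1 n k \<subseteq> par_I n k" "par_I3 n k \<subseteq> par_I n k" by auto
  qed
  show "par_I2 n k \<subseteq> par_I n k"
  proof
    fix P assume P: "P \<in> par_I2 n k"
    have "\<theta> P (n - k + i) = (-1) ^ (k - i) * (a P 2 + 1) ^ (k - i) * \<theta> P n" if "i \<in> {1..k}" for i
      using P that top(1) by (cases "i = k") (auto simp: par_I2_def)
    then show "P \<in> par_I n k" using P k_pos by (auto simp: par_I2_def par_I_iff)
  qed
  show "par_I4 n k \<subseteq> par_I n k"
  proof
    fix P assume P: "P \<in> par_I4 n k"
    have "\<theta> P (n - k + i) = (-1) ^ (k - i) * (a P 2 + 1) ^ (k - i) * \<theta> P n" if "i \<in> {1..k}" for i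
      using P that top(1) by (cases "i = k") (auto simp: par_I4_def)
    then show "P \<in> par_I n k" using P by (auto simp: par_I4_def par_I_iff m_eq)
  qed
qed

lemma reduction_a1_zero:
  assumes P: "P \<in> par_I n k" and a1: "a P 1 = 0"
  shows "\<exists>Q \<in> par_I1 n k \<union> par_I2 n k \<union> par_I3 n k. R_alg n k P \<simeq> R_alg n k Q"
proof -
  define Q where "Q = P\<lparr>b1 := 0, b2 := (if a P 2 = -1 then b2 P else 0),
    \<delta>2 := (if a P 2 = 0 then \<delta>2 P else 0), \<delta>3 := (if a P 2 = -1 then \<delta>3 P else 0)\<rparr>"
  have Q: "Q \<in> par_I1 n k \<union> par_I2 n k \<union> par_I3 n k"
  proof (cases "a P 2 = -1")
    case True
    have "\<theta> P (n - k + i) = 0" if "i \<in> {1..k - 1}" for i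
    proof -
      have "i \<in> {1..k}" "k - i \<noteq> 0" using that by auto
      then show ?thesis using P True by (simp add: par_I_iff)
    qed
    then have "Q \<in> par_I2 n k" using P a1 True by (auto simp: par_I2_def par_I_iff Q_def)
    then show ?thesis by simp
  next
    case False
    then have "a P 2 + 1 \<noteq> 0" by (simp add: add_eq_0_iff2)
    then have "\<theta> P n = 0" using P a1 by (auto simp: par_I_iff)
    then have "Q \<in> par_I1 n k \<union> par_I3 n k"
      using False P a1 by (auto simp: par_I1_def par_I3_def par_I_iff Q_def)
    then show ?thesis by blast
  qed
  then have "Q \<in> par_I n k" using subfamilies_subset by blast
  then have "leibniz_algebra (R_alg n k Q)" using R_alg_leibniz k_pos m_ge m_eq by simp
  then have "R_alg n k P \<simeq> R_alg n k Q"
    by (rule isomorphic_if_a1_zero[OF _ a1]) (auto simp: Q_def add_eq_0_iff2)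
  then show ?thesis using Q by blast
qed

lemma reduction_a1_nonzero:
  assumes P: "P \<in> par_I n k" and a1: "a P 1 \<noteq> 0"
  shows "\<exists>Q \<in> par_I4 n k. R_alg n k P \<simeq> R_alg n k Q"
proof -
  define Q where "Q = P\<lparr>a := (\<lambda>i. if 4 \<le> i \<and> i < m then 0 else a P i), \<beta> := 0\<rparr>"
  have \<gamma>: "\<gamma> P = 0" using P a1 by (simp add: par_I_iff)
  have "b2 P * a P 1 = (-1) ^ (k - 1) * (a P 2 + 1) ^ k * \<theta> P n"
    using P by (subst mult.commute) (simp add: par_I_iff)
  then have "b2 P = (-1) ^ (k - 1) * (a P 2 + 1) ^ k * \<theta> P n / a P 1"
    by (simp only: nonzero_eq_divide_eq[OF a1])
  then have Q: "Q \<in> par_I4 n k"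
    using P a1 \<gamma> m_ge by (auto simp: par_I4_def par_I_iff Q_def m_eq)
  then have "leibniz_algebra (R_alg n k Q)"
    using R_alg_leibniz k_pos m_ge m_eq subfamilies_subset(4) by (simp add: subset_iff)
  then have "R_alg n k P \<simeq> R_alg n k Q"
    by (rule isomorphic_if_a1_nonzero[OF P _ a1]) (auto simp: \<gamma> Q_def)
  then show ?thesis using Q by blast
qed

end

theorem proposition4p10:
  fixes n k :: nat
  assumes "k \<ge> 1" and "n - 2 * k \<ge> 5"
  shows "(\<forall>A \<in> R_family n k (par_I n k).
            \<exists>B \<in> R_family n k (par_I1 n k) \<union> R_family n k (par_I2 n k) \<union>
                  R_family n k (par_I3 n k) \<union> R_family n k (par_I4 n k). A \<simeq> B) \<and>
         R_family n k (par_I1 n k) \<union> R_family n k (par_I2 n k) \<union>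
         R_family n k (par_I3 n k) \<union> R_family n k (par_I4 n k) \<subseteq> R_family n k (par_I n k)"
proof
  interpret table_shape n k "n - 2 * k"
    by standard (use assms in simp_all)
  show "\<forall>A \<in> R_family n k (par_I n k).
            \<exists>B \<in> R_family n k (par_I1 n k) \<union> R_family n k (par_I2 n k) \<union>
                  R_family n k (par_I3 n k) \<union> R_family n k (par_I4 n k). A \<simeq> B"
  proof
    fix A assume "A \<in> R_family n k (par_I n k)"
    then obtain P where P: "P \<in> par_I n k" "A = R_alg n k P" by (auto simp: R_family_def)
    have "\<exists>Q \<in> par_I1 n k \<union> par_I2 n k \<union> par_I3 n k \<union> par_I4 n k. A \<simeq> R_alg n k Q"
      unfolding P(2) using reduction_a1_zero[OF P(1)] reduction_a1_nonzero[OF P(1)]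
      by (cases "a P 1 = 0") auto
    then show "\<exists>B \<in> R_family n k (par_I1 n k) \<union> R_family n k (par_I2 n k) \<union>
        R_family n k (par_I3 n k) \<union> R_family n k (par_I4 n k). A \<simeq> B"
      unfolding R_family_def image_Un[symmetric] by (elim bexE) (rule bexI, assumption, rule imageI)
  qed
  show "R_family n k (par_I1 n k) \<union> R_family n k (par_I2 n k) \<union>
         R_family n k (par_I3 n k) \<union> R_family n k (par_I4 n k) \<subseteq> R_family n k (par_I n k)"
    unfolding R_family_def by (intro Un_least image_mono subfamilies_subset)
qed

end
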